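(* Let $\delta\in(0,1/10)$, $K\ge 2$, $M\ge1$, and $N\ge 2$ an integer. Suppose $\alpha,a\in\mathbb R^d$, $\beta\in\mathbb R$, $|a|\le M$, and $\|\beta+a\cdot\{\alpha h\}\|_{\mathbb R/\mathbb Z}<K/N$ for at least $\delta N$ values $h\in[N]$. Then at least one of the following holds: (1) $N\ll(\delta/(d^dM))^{-O(1)}$ or $K/N>1/100$; (2) there exist an integer $r$, linearly independent $w_1,\dots,w_r\in\mathbb Z^d$ with $|w_1||w_2|\cdots|w_r|\le(\delta/(d^dM))^{-O(1)}$, and linearly independent $\eta_1,\dots,\eta_{d-r}\in\mathbb Z^d$ of size at most $(\delta/(d^dM))^{-O(1)}$ such that $\langle w_i,\eta_j\rangle=0$ for all $i,j$ and \[\|\eta_j\cdot\alpha\|_{\mathbb R/\mathbb Z}\le\frac{(\delta/M)^{-O(1)}d^{O(d)}K}{N},\qquad |w_i\cdot a|\le\frac{(\delta/M)^{-O(1)}d^{O(d)}K}{N}.\]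
   Context: For $r\in\mathbb R$, $\{r\}\in(-1/2,1/2]$ denotes $r$ minus a nearest integer; for $x\in\mathbb R^d$, $\{x\}$ is taken coordinatewise. $|v|=\|v\|_\infty$. $[N]=\{1,\dots,N\}$. Implied constants in $O(1)$ are absolute. *)

theory Defs
  imports Complex_Main
begin

(* {r}: r minus a nearest integer, taking values in (-1/2, 1/2] *)
definition sfrac :: "real \<Rightarrow> real" where
  "sfrac r = r - real_of_int \<lceil>r - 1/2\<rceil>"

definition normRZ :: "real \<Rightarrow> real" where
  "normRZ r = \<bar>sfrac r\<bar>"

(* vectors in R^d / Z^d are functions on indices {0..<d} *)
definition supn :: "nat \<Rightarrow> (nat \<Rightarrow> 'a::linordered_idom) \<Rightarrow> 'a" where
  "supn d v = Max (insert 0 ((\<lambda>k. \<bar>v k\<bar>) ` {..<d}))"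

definition dotp :: "nat \<Rightarrow> (nat \<Rightarrow> 'a::comm_ring_1) \<Rightarrow> (nat \<Rightarrow> 'a) \<Rightarrow> 'a" where
  "dotp d u v = (\<Sum>k<d. u k * v k)"

definition lin_indep_int :: "nat \<Rightarrow> nat \<Rightarrow> (nat \<Rightarrow> nat \<Rightarrow> int) \<Rightarrow> bool" where
  "lin_indep_int d m v \<longleftrightarrow>
     (\<forall>c :: nat \<Rightarrow> real. (\<forall>k<d. (\<Sum>i<m. c i * real_of_int (v i k)) = 0) \<longrightarrow> (\<forall>i<m. c i = 0))"

end

theory Submission
  imports Defs "Jordan_Normal_Form.Determinant"
begin

text \<open>
  Pigeonholing on the nearest integer to \<open>\<beta> + a \<cdot> {\<alpha>h}\<close> and on the signs of the coordinates of \<open>{\<alpha>h}\<close>,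
  and then taking differences, gives many integers \<open>h\<close> with \<open>\<bar>h\<bar> \<le> N\<close> together with representatives \<open>x(h)\<close>
  of \<open>\<alpha>h\<close> modulo 1 in \<open>[-1/2, 1/2]\<^sup>d\<close> such that \<open>\<bar>a \<cdot> x(h)\<bar> \<le> 2K/N\<close>. Let \<open>V\<close> be the span of the points
  \<open>(x(h), h)\<close>, of dimension \<open>n = r + 1\<close>. A coordinate minor of largest absolute value, constrained to
  contain the coordinate \<open>h\<close>, identifies \<open>V\<close> with \<open>\<real>\<^sup>n\<close> so that all other coordinates are linear forms
  with coefficients at most 1 in the chosen \<open>x\<^sub>i\<close>. The lattice points of \<open>V\<close> then become a subgroup \<open>G\<close>
  of \<open>\<int>\<^sup>n\<close>.

  Coset representatives of \<open>\<int>\<^sup>n\<close> modulo \<open>G\<close> can be moved into the parallelepiped spanned by \<open>n\<close> of the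
  points; their translates by all the points are distinct and lie in a box with \<open>d\<^bsup>O(d)\<^esup> N\<close> lattice points.
  Hence the index \<open>q\<close> of \<open>G\<close> is small. Since \<open>q\<close> annihilates \<open>\<int>\<^sup>n/G\<close>, it clears the denominators of the
  linear forms, and these forms are the \<open>\<eta>\<^sub>j\<close>. The same packing argument with \<open>\<int>\<^sup>n\<close> refined to \<open>(1/R)\<int>\<^sup>n\<close>, \<open>R\<close> large,
  bounds the restriction of \<open>a\<close> to \<open>V \<inter> {h = 0}\<close>, because the points lie in a thin slab. Finally the \<open>w\<^sub>i\<close>
  come from Minkowski's second theorem for the lattice \<open>V \<inter> {h = 0} \<inter> \<int>\<^sup>d\<close>, whose covolume is controlled by \<open>q\<close>.
  All losses are polynomial in \<open>d\<^sup>d M/\<delta>\<close>.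
\<close>

section \<open>Counting and maximal minors\<close>

text \<open>Reveal the coordinates one after another: once the earlier ones are fixed, coordinate i
  takes integer values in an interval of length \<open>b i\<close>, so at most
  \<open>b i + 1\<close> of them. Making the width conditional on earlier coordinates lets the lemma
  count sheared boxes and slabs.\<close>

lemma card_le_prod_fibre_widths:
  fixes u :: "nat \<Rightarrow> 'a \<Rightarrow> int" and b :: "nat \<Rightarrow> real"
  assumes "\<And>i. i < n \<Longrightarrow> 0 \<le> b i"
    and "\<And>z z'. z \<in> S \<Longrightarrow> z' \<in> S \<Longrightarrow> (\<forall>i<n. u i z = u i z') \<Longrightarrow> z = z'"
    and "\<And>i z z'. i < n \<Longrightarrow> z \<in> S \<Longrightarrow> z' \<in> S \<Longrightarrow> (\<forall>k<i. u k z = u k z') \<Longrightarrow>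
           real_of_int (u i z - u i z') \<le> b i"
  shows "finite S \<and> real (card S) \<le> (\<Prod>i<n. b i + 1)"
  using assms
proof (induction n arbitrary: S u b)
  case 0
  then have "S = {} \<or> (\<exists>z. S = {z})" by blast
  then show ?case by auto
next
  case (Suc n)
  let ?fib = "\<lambda>v. {z \<in> S. u 0 z = v}" and ?B = "\<Prod>i<n. b (Suc i) + 1"
  have b0: "0 \<le> b 0" using Suc.prems(1) by auto
  have width: "real_of_int (v - v') \<le> b 0" if "v \<in> u 0 ` S" "v' \<in> u 0 ` S" for v v'
    using that Suc.prems(3)[of 0] by auto
  have V: "finite (u 0 ` S) \<and> real (card (u 0 ` S)) \<le> b 0 + 1"
  proof (cases "S = {}")
    case True
    then show ?thesis using b0 by simp
  next
    case False
    then obtain v0 where v0: "v0 \<in> u 0 ` S" by blast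
    have "v \<in> {v0 - \<lfloor>b 0\<rfloor> .. v0 + \<lfloor>b 0\<rfloor>}" if "v \<in> u 0 ` S" for v
      using width[OF that v0] width[OF v0 that] by simp linarith
    then have fin: "finite (u 0 ` S)" by (meson finite_atLeastAtMost_int finite_subset subsetI)
    let ?m = "Min (u 0 ` S)" and ?M = "Max (u 0 ` S)"
    have "?m \<in> u 0 ` S" "?M \<in> u 0 ` S" using fin v0 by (auto intro!: Min_in Max_in)
    moreover from this have "?m \<le> ?M" using fin by (intro Min_le) auto
    moreover have "card (u 0 ` S) \<le> card {?m..?M}"
      using fin by (intro card_mono) auto
    ultimately have "int (card (u 0 ` S)) \<le> ?M - ?m + 1" "real_of_int (?M - ?m) \<le> b 0"
      using width[of ?M ?m] by (auto simp: nat_le_iff)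
    then show ?thesis using fin by linarith
  qed
  have fib: "finite (?fib v) \<and> real (card (?fib v)) \<le> ?B" for v
  proof (rule Suc.IH[of "\<lambda>i. b (Suc i)" "?fib v" "\<lambda>i. u (Suc i)"])
    show "0 \<le> b (Suc i)" if "i < n" for i using Suc.prems(1) that by simp
    show "z = z'" if "z \<in> ?fib v" "z' \<in> ?fib v" "\<forall>i<n. u (Suc i) z = u (Suc i) z'" for z z'
      using that by (intro Suc.prems(2)) (auto simp: less_Suc_eq_0_disj)
    show "real_of_int (u (Suc i) z - u (Suc i) z') \<le> b (Suc i)"
      if "i < n" "z \<in> ?fib v" "z' \<in> ?fib v" "\<forall>k<i. u (Suc k) z = u (Suc k) z'" for i z z'
      using that by (intro Suc.prems(3)) (auto simp: less_Suc_eq_0_disj)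
  qed
  have S: "S = (\<Union>v\<in>u 0 ` S. ?fib v)" by auto
  have fin: "finite S" using V fib by (subst S) blast
  have "card S \<le> (\<Sum>v\<in>u 0 ` S. card (?fib v))"
    using card_UN_le[of "u 0 ` S" ?fib] V unfolding S[symmetric] by blast
  then have "real (card S) \<le> (\<Sum>v\<in>u 0 ` S. real (card (?fib v)))"
    by (metis of_nat_le_iff of_nat_sum)
  also have "\<dots> \<le> real (card (u 0 ` S)) * ?B"
    using fib sum_bounded_above[of "u 0 ` S" "\<lambda>v. real (card (?fib v))" ?B] by auto
  also have "\<dots> \<le> (b 0 + 1) * ?B"
    using V Suc.prems(1) by (intro mult_right_mono prod_nonneg) auto
  also have "\<dots> = (\<Prod>i<Suc n. b i + 1)"
    by (simp only: prod.lessThan_Suc_shift)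
  finally show ?case using fin by blast
qed

section \<open>Linear algebra: coordinates from a minor of largest absolute value\<close>

lemma nonsingular_solvable:
  fixes A :: "real mat"
  assumes A: "A \<in> carrier_mat n n" and "det A \<noteq> 0" and b: "b \<in> carrier_vec n"
  shows "\<exists>x\<in>carrier_vec n. A *\<^sub>v x = b"
proof -
  from det_non_zero_imp_unit[OF A assms(2), of "()"]
  obtain B where B: "B \<in> carrier_mat n n" and AB: "A * B = 1\<^sub>m n"
    unfolding Units_def ring_mat_def by auto
  have "A *\<^sub>v (B *\<^sub>v b) = b"
    using assoc_mult_mat_vec[OF A B b] AB b by simp
  then show ?thesis using B b by (intro bexI[of _ "B *\<^sub>v b"]) auto
qed

text \<open>Take the largest size n of a nonsingular minor that contains column d, fix its rows
  \<open>g\<close>, and then choose the columns \<open>f\<close> so that the minor is largest in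
  absolute value. Maximal size gives the linear relations, maximal value gives the bound on their
  coefficients.\<close>

lemma spanning_minor:
  fixes X :: "'a \<Rightarrow> nat \<Rightarrow> real"
  assumes h0: "h0 \<in> P" "X h0 d \<noteq> 0"
  obtains n :: nat and f g c where "0 < n" "f 0 = d" "\<And>i. 0 < i \<Longrightarrow> i < n \<Longrightarrow> f i < d" "inj_on f {..<n}"
    "\<And>k. k < n \<Longrightarrow> g k \<in> P"
    "\<And>h j. h \<in> P \<Longrightarrow> j < d \<Longrightarrow> X h j = (\<Sum>i<n. c j i * X h (f i))"
    "\<And>j i. j < d \<Longrightarrow> 0 < i \<Longrightarrow> i < n \<Longrightarrow> \<bar>c j i\<bar> \<le> 1"
    "\<And>y. \<exists>s. \<forall>i<n. y i = (\<Sum>k<n. s k * X (g k) (f i))"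
proof -
  define A where "A n g f = mat n n (\<lambda>(k,i). X (g k) (f i))" for n and g :: "nat \<Rightarrow> 'a" and f
  have Ac: "A n g f \<in> carrier_mat n n" for n g f by (simp add: A_def)
  have A_mult: "(A n g f *\<^sub>v v) $ k = (\<Sum>i<n. X (g k) (f i) * v $ i)"
    if "v \<in> carrier_vec n" "k < n" for n g f v k
    using that by (simp add: A_def scalar_prod_def lessThan_atLeast0)
  define valid where "valid n f \<longleftrightarrow> f 0 = d \<and> (\<forall>i. 0 < i \<and> i < n \<longrightarrow> f i < d)" for n and f :: "nat \<Rightarrow> nat"
  define ok where "ok n \<longleftrightarrow> 0 < n \<and> (\<exists>g f. valid n f \<and> (\<forall>k<n. g k \<in> P) \<and> det (A n g f) \<noteq> 0)" for n
  have inj: "inj_on f {..<n}" if "det (A n g f) \<noteq> 0" for n g f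
  proof (rule inj_onI, rule ccontr)
    fix i j assume ij: "i \<in> {..<n}" "j \<in> {..<n}" "f i = f j" "i \<noteq> j"
    have "col (A n g f) i = col (A n g f) j"
      using ij by (intro eq_vecI) (auto simp: A_def)
    then show False using det_identical_columns[OF Ac, of i j n g f] ij that by auto
  qed
  have "ok 1" unfolding ok_def
    using h0 by (intro conjI exI[of _ "\<lambda>_. h0"] exI[of _ "\<lambda>_. d"])
      (auto simp: valid_def A_def det_single)
  moreover have "n \<le> Suc d" if "ok n" for n
  proof -
    from that obtain g f where *: "valid n f" "det (A n g f) \<noteq> 0" unfolding ok_def by auto
    have "f ` {..<n} \<subseteq> {..d}"
      using *(1) unfolding valid_def by (auto, metis less_imp_le gr0I order_refl)
    then have "card (f ` {..<n}) \<le> Suc d" using card_mono[of "{..d}"] by fastforce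
    then show ?thesis using card_image[OF inj[OF *(2)]] by simp
  qed
  ultimately obtain n where n: "ok n" and n_max: "\<not> ok (Suc n)"
    by (metis GreatestI_nat Greatest_le_nat Suc_n_not_le_n)
  from n obtain g f0 where n0: "0 < n" and g: "\<And>k. k < n \<Longrightarrow> g k \<in> P" and f0: "valid n f0" "det (A n g f0) \<noteq> 0"
    unfolding ok_def by auto
  \<comment> \<open>Column choices are normalised to 0 outside \<open>{..<n}\<close>. This makes the
    set finite, so a largest minor exists; \<open>restr\<close> carries the maximality back to all
    admissible choices.\<close>
  define F where "F = {f. (\<forall>i. (i \<in> {..<n} \<longrightarrow> f i \<in> {..d}) \<and> (i \<notin> {..<n} \<longrightarrow> f i = 0)) \<and> valid n f}"
  have A_cong: "A n g f = A n g f'" if "\<And>i. i < n \<Longrightarrow> f i = f' i" for f f'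
    using that by (intro eq_matI) (auto simp: A_def)
  have restr: "\<exists>f'\<in>F. A n g f' = A n g f" if "valid n f" for f
  proof (rule bexI[of _ "\<lambda>i. if i < n then f i else 0"])
    show "A n g (\<lambda>i. if i < n then f i else 0) = A n g f" by (rule A_cong) auto
    have "f i \<le> d" if "i < n" for i
      using that \<open>valid n f\<close> unfolding valid_def by (cases "i = 0") (auto intro: less_imp_le)
    then show "(\<lambda>i. if i < n then f i else 0) \<in> F" using that n0 unfolding F_def valid_def by auto
  qed
  have finF: "finite F"
    unfolding F_def by (rule finite_subset[OF _ finite_set_of_finite_funs[of "{..<n}" "{..d}" 0]]) auto
  have "F \<noteq> {}" using restr[OF f0(1)] by auto
  then have "Max ((\<lambda>f. \<bar>det (A n g f)\<bar>) ` F) \<in> (\<lambda>f. \<bar>det (A n g f)\<bar>) ` F"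
    using finF by (intro Max_in) auto
  then obtain f where f: "f \<in> F" and f_Max: "Max ((\<lambda>f. \<bar>det (A n g f)\<bar>) ` F) = \<bar>det (A n g f)\<bar>"
    by auto
  have f_max: "\<bar>det (A n g f')\<bar> \<le> \<bar>det (A n g f)\<bar>" if "f' \<in> F" for f'
    unfolding f_Max[symmetric] using finF that by (intro Max_ge) auto
  have f_max': "\<bar>det (A n g f')\<bar> \<le> \<bar>det (A n g f)\<bar>" if "valid n f'" for f'
    using restr[OF that] f_max by metis
  have det: "det (A n g f) \<noteq> 0" using f_max'[OF f0(1)] f0(2) by auto
  have vf: "valid n f" using f by (simp add: F_def)
  define b where "b j = vec n (\<lambda>k. X (g k) j)" for j
  have bc: "b j \<in> carrier_vec n" for j by (simp add: b_def)
  define cv where "cv j = (SOME x. x \<in> carrier_vec n \<and> A n g f *\<^sub>v x = b j)" for j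
  have cv: "cv j \<in> carrier_vec n" "A n g f *\<^sub>v cv j = b j" for j
    using someI_ex[of "\<lambda>x. x \<in> carrier_vec n \<and> A n g f *\<^sub>v x = b j"]
      nonsingular_solvable[OF Ac det bc[of j]] unfolding cv_def by blast+
  define c where "c j i = cv j $ i" for j i
  have cg: "X (g k) j = (\<Sum>i<n. X (g k) (f i) * c j i)" if "k < n" for k j
    using A_mult[OF cv(1) that, of g f j] that unfolding cv(2) by (simp add: b_def c_def)
  \<comment> \<open>By Cramer's rule \<open>c j i\<close> is a quotient of two minors, the numerator
    having column i replaced by coordinate j. The replacement is admissible only for i > 0, since
    column 0 must remain coordinate d; hence there is no such bound on \<open>c j 0\<close>.\<close>
  have c_le: "\<bar>c j i\<bar> \<le> 1" if "j < d" "0 < i" "i < n" for j i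
  proof -
    have "replace_col (A n g f) (b j) i = A n g (f(i := j))"
      by (rule eq_matI) (auto simp: replace_col_def A_def b_def)
    then have "det (A n g (f(i := j))) = c j i * det (A n g f)"
      using cramer_lemma_mat[OF Ac cv(1) that(3), of g f j] unfolding cv(2) c_def by simp
    moreover have "valid n (f(i := j))" using vf that by (auto simp: valid_def)
    ultimately have "\<bar>c j i\<bar> * \<bar>det (A n g f)\<bar> \<le> \<bar>det (A n g f)\<bar>" 
      using f_max'[of "f(i := j)"] by (simp add: abs_mult)
    then show ?thesis using det by simp
  qed
  \<comment> \<open>Bordering the minor by row h and column j gives a singular matrix, as n is the
    largest size. A kernel vector has nonzero last entry, otherwise the minor itself would have a
    kernel; dividing by that entry gives the relation at h.\<close>
  have rel: "X h j = (\<Sum>i<n. c j i * X h (f i))" if h: "h \<in> P" and j: "j < d" for h j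
  proof -
    let ?g = "g(n := h)" and ?f = "f(n := j)"
    have "valid (Suc n) ?f" using vf n0 j by (auto simp: valid_def)
    moreover have "\<forall>k<Suc n. ?g k \<in> P" using g h by auto
    ultimately have "det (A (Suc n) ?g ?f) = 0" using n_max unfolding ok_def by blast
    then obtain v where v: "v \<in> carrier_vec (Suc n)" "v \<noteq> 0\<^sub>v (Suc n)"
        and v0: "A (Suc n) ?g ?f *\<^sub>v v = 0\<^sub>v (Suc n)"
      using det_0_iff_vec_prod_zero[OF Ac] by blast
    have eq: "(\<Sum>i<n. X (?g k) (f i) * v $ i) + X (?g k) j * v $ n = 0" if "k < Suc n" for k
      using A_mult[OF v(1) that, of ?g ?f] that v0 by simp
    define u where "u = vec n (\<lambda>i. v $ i + v $ n * c j i)"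
    have uc: "u \<in> carrier_vec n" by (simp add: u_def)
    have "A n g f *\<^sub>v u = 0\<^sub>v n"
    proof (rule eq_vecI)
      fix k assume "k < dim_vec (0\<^sub>v n)"
      then have k: "k < n" by simp
      have "(A n g f *\<^sub>v u) $ k = (\<Sum>i<n. X (g k) (f i) * v $ i) + v $ n * (\<Sum>i<n. X (g k) (f i) * c j i)"
        unfolding A_mult[OF uc k] by (simp add: u_def algebra_simps sum.distrib sum_distrib_left)
      also have "\<dots> = 0" using eq[of k] k cg[OF k, of j] by (simp add: mult.commute)
      finally show "(A n g f *\<^sub>v u) $ k = 0\<^sub>v n $ k" using k by simp
    qed (use Ac in auto)
    then have "u = 0\<^sub>v n" using det_0_iff_vec_prod_zero[OF Ac[of n g f]] uc det by blast
    then have vi: "v $ i = - v $ n * c j i" if "i < n" for i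
      using that by (auto simp: u_def vec_eq_iff add_eq_0_iff)
    have "v $ n \<noteq> 0"
    proof
      assume "v $ n = 0"
      then have "v = 0\<^sub>v (Suc n)" using v(1) vi by (intro eq_vecI) (auto simp: less_Suc_eq)
      with v(2) show False by simp
    qed
    moreover have "v $ n * (X h j - (\<Sum>i<n. c j i * X h (f i))) = 0"
      using eq[of n] vi by (simp add: sum_distrib_left algebra_simps sum_negf)
    ultimately show ?thesis by simp
  qed
  have span: "\<exists>s. \<forall>i<n. y i = (\<Sum>k<n. s k * X (g k) (f i))" for y
  proof -
    have "det (A n g f)\<^sup>T \<noteq> 0" using det det_transpose[OF Ac] by metis
    then obtain s where s: "s \<in> carrier_vec n" "(A n g f)\<^sup>T *\<^sub>v s = vec n y"
      using nonsingular_solvable[of "(A n g f)\<^sup>T" n "vec n y"] Ac by auto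
    have "y i = (\<Sum>k<n. s $ k * X (g k) (f i))" if "i < n" for i
    proof -
      have "y i = ((A n g f)\<^sup>T *\<^sub>v s) $ i" using s(2) that by simp
      also have "\<dots> = (\<Sum>k<n. s $ k * X (g k) (f i))"
        using that s(1) by (simp add: A_def scalar_prod_def lessThan_atLeast0 mult.commute)
      finally show ?thesis .
    qed
    then show ?thesis by blast
  qed
  have f: "f 0 = d" "\<And>i. 0 < i \<Longrightarrow> i < n \<Longrightarrow> f i < d" using vf by (auto simp: valid_def)
  show thesis by (rule that[of n f g c]; fact n0 f inj[OF det] g rel c_le span)
qed
section \<open>Minkowski's second theorem for integer lattices\<close>

lemma supn_le_iff: "supn d v \<le> R \<longleftrightarrow> 0 \<le> R \<and> (\<forall>k<d. \<bar>v k\<bar> \<le> R)"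
  unfolding supn_def by (subst Max_le_iff) auto

lemma supn_nonneg: "0 \<le> supn d v"
  unfolding supn_def by (rule Max_ge) auto

lemma abs_le_supn: "k < d \<Longrightarrow> \<bar>v k\<bar> \<le> supn d v"
  using supn_le_iff[of d v "supn d v"] by auto

lemma lin_indep_intD:
  assumes "lin_indep_int d m v" and "\<And>k. k < d \<Longrightarrow> (\<Sum>i<m. c i * real_of_int (v i k)) = 0" and "i < m"
  shows "c i = 0"
  using spec[OF assms(1)[unfolded lin_indep_int_def], of c] assms(2,3) by simp

lemma lin_indep_int_unique:
  assumes "lin_indep_int d r w" "m \<le> r" "l < m"
    and "\<And>k. k < d \<Longrightarrow> (\<Sum>i<m. c i * real_of_int (w i k)) = (\<Sum>i<m. c' i * real_of_int (w i k))"
  shows "c l = c' l"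
proof -
  let ?c = "\<lambda>i. if i < m then c i - c' i else 0"
  have "(\<Sum>i<r. ?c i * real_of_int (w i k)) = 0" if "k < d" for k
  proof -
    have "(\<Sum>i<r. ?c i * real_of_int (w i k)) = (\<Sum>i<m. ?c i * real_of_int (w i k))"
      using assms(2) by (intro sum.mono_neutral_right) auto
    also have "\<dots> = (\<Sum>i<m. c i * real_of_int (w i k)) - (\<Sum>i<m. c' i * real_of_int (w i k))"
      by (simp add: left_diff_distrib sum_subtractf)
    finally show ?thesis using assms(4)[OF that] by simp
  qed
  from lin_indep_intD[OF assms(1) this, of l] show ?thesis using assms(2,3) by simp
qed

lemma lin_indep_int_supn_pos:
  assumes "lin_indep_int d r w" "i < r"
  shows "0 < supn d (w i)"
proof (rule ccontr)
  assume "\<not> 0 < supn d (w i)"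
  then have "supn d (w i) \<le> 0" by simp
  then have 0: "w i k = 0" if "k < d" for k using that by (auto simp: supn_le_iff)
  have "(\<Sum>j<r. (if j = i then 1 else 0) * real_of_int (w j k)) = 0" if "k < d" for k
    using 0[OF that] by (intro sum.neutral) auto
  from lin_indep_intD[OF assms(1) this assms(2)] show False by simp
qed

text \<open>A subgroup of Z^d. Vectors vanish from index d on, so that equality of vectors is
  equality of functions.\<close>

locale int_lattice =
  fixes d :: nat and L :: "(nat \<Rightarrow> int) set"
  assumes support: "v \<in> L \<Longrightarrow> d \<le> k \<Longrightarrow> v k = 0"
    and zero_mem: "(\<lambda>_. 0) \<in> L"
    and add_mult_mem: "u \<in> L \<Longrightarrow> v \<in> L \<Longrightarrow> (\<lambda>k. u k + s * v k) \<in> L"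
begin

lemma add_sum_mem:
  fixes m :: nat
  shows "v \<in> L \<Longrightarrow> (\<And>i. i < m \<Longrightarrow> u i \<in> L) \<Longrightarrow> (\<lambda>k. v k + (\<Sum>i<m. s i * u i k)) \<in> L"
proof (induction m)
  case (Suc m)
  then show ?case using add_mult_mem[of "\<lambda>k. v k + (\<Sum>i<m. s i * u i k)" "u m" "s m"]
    by (simp add: add.assoc)
qed simp

lemma finite_bounded: "finite {v \<in> L. \<forall>k<d. real_of_int \<bar>v k\<bar> \<le> R}"
proof (rule finite_subset)
  show "{v \<in> L. \<forall>k<d. real_of_int \<bar>v k\<bar> \<le> R} \<subseteq>
    {v. \<forall>k. (k \<in> {..<d} \<longrightarrow> v k \<in> {-\<lfloor>R\<rfloor>..\<lfloor>R\<rfloor>}) \<and> (k \<notin> {..<d} \<longrightarrow> v k = 0)}"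
  proof (clarify, intro conjI impI)
    fix v k assume v: "v \<in> L" "\<forall>k<d. real_of_int \<bar>v k\<bar> \<le> R"
    show "v k = 0" if "k \<notin> {..<d}" using support[OF v(1)] that by auto
    show "v k \<in> {-\<lfloor>R\<rfloor>..\<lfloor>R\<rfloor>}" if "k \<in> {..<d}"
    proof -
      have "\<bar>v k\<bar> \<le> \<lfloor>R\<rfloor>" using v(2) that by (auto simp: le_floor_iff)
      then show ?thesis by auto
    qed
  qed
qed (rule finite_set_of_finite_funs; simp)

text \<open>In step m pick, among the reduced lattice vectors in the span of \<open>w 0\<close>,
  ..., \<open>w m\<close>, one whose coefficient at \<open>w m\<close> is positive and least.
  Division with remainder by it sends any lattice vector of this span into the span of the earlier
  \<open>w\<close>, where the induction hypothesis applies.\<close>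

lemma adapted_basis:
  assumes wL: "\<forall>i<r. w i \<in> L" and indep: "lin_indep_int d r w" and "m \<le> r"
  shows "\<exists>z b. (\<forall>i<m. z i \<in> L \<and> b i i > 0 \<and> (\<forall>l>i. b i l = 0) \<and>
           (\<forall>k<d. real_of_int (z i k) = (\<Sum>l<r. b i l * real_of_int (w l k)))) \<and>
         (\<forall>v c. v \<in> L \<longrightarrow> (\<forall>k<d. real_of_int (v k) = (\<Sum>l<m. c l * real_of_int (w l k))) \<longrightarrow>
           (\<exists>s::nat \<Rightarrow> int. \<forall>k. v k = (\<Sum>i<m. s i * z i k)))"
  using \<open>m \<le> r\<close>
proof (induction m)
  case 0
  have "\<forall>k. v k = 0" if "v \<in> L" "\<forall>k<d. real_of_int (v k) = 0" for v
    using that support[of v] by (metis leI of_int_eq_0_iff)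
  then show ?case by simp
next
  case (Suc m)
  then have m: "m < r" by simp
  from Suc.IH[OF less_imp_le[OF m]] obtain z b where zb: "\<forall>i<m. z i \<in> L \<and> b i i > 0 \<and> (\<forall>l>i. b i l = 0) \<and>
           (\<forall>k<d. real_of_int (z i k) = (\<Sum>l<r. b i l * real_of_int (w l k)))"
    and gen: "\<forall>v c. v \<in> L \<longrightarrow> (\<forall>k<d. real_of_int (v k) = (\<Sum>l<m. c l * real_of_int (w l k))) \<longrightarrow>
           (\<exists>s::nat \<Rightarrow> int. \<forall>k. v k = (\<Sum>i<m. s i * z i k))"
    by (elim exE conjE)
  define rep where "rep v c \<longleftrightarrow> (\<forall>k<d. real_of_int (v k) = (\<Sum>l<Suc m. c l * real_of_int (w l k)))"
    for v :: "nat \<Rightarrow> int" and c :: "nat \<Rightarrow> real"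
  \<comment> \<open>The coefficient at \<open>w m\<close> may equal 1, so that \<open>w m\<close>
    itself belongs to \<open>E\<close>. Bounded coefficients make \<open>E\<close> finite, hence a
    least coefficient exists.\<close>
  define red where "red c \<longleftrightarrow> (\<forall>l<m. 0 \<le> c l \<and> c l < 1) \<and> 0 < c m \<and> c m \<le> 1" for c :: "nat \<Rightarrow> real"
  define E where "E = {v \<in> L. \<exists>c. rep v c \<and> red c}"
  have rep_unique: "c l = c' l" if "rep v c" "rep v c'" "l < Suc m" for v c c' l
    using that by (intro lin_indep_int_unique[OF indep Suc.prems, where c = c and c' = c']) (auto simp: rep_def)
  have "E \<subseteq> {v \<in> L. \<forall>k<d. real_of_int \<bar>v k\<bar> \<le> (\<Sum>l<Suc m. real_of_int (supn d (w l)))}"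
  proof clarify
    fix v assume "v \<in> E"
    then obtain c where v: "v \<in> L" and c: "rep v c" "red c" unfolding E_def by auto
    have "real_of_int \<bar>v k\<bar> \<le> (\<Sum>l<Suc m. real_of_int (supn d (w l)))" if "k < d" for k
    proof -
      have "\<bar>c l * real_of_int (w l k)\<bar> \<le> real_of_int (supn d (w l))" if "l < Suc m" for l
      proof -
        have "\<bar>c l\<bar> \<le> 1" using c(2) that unfolding red_def by (cases "l = m") (auto simp: less_Suc_eq)
        moreover have "\<bar>real_of_int (w l k)\<bar> \<le> real_of_int (supn d (w l))"
          using abs_le_supn[OF \<open>k < d\<close>, of "w l"] by linarith
        ultimately show ?thesis unfolding abs_mult by (metis abs_ge_zero mult_mono mult_1 zero_le_one)
      qed
      then have "\<bar>\<Sum>l<Suc m. c l * real_of_int (w l k)\<bar> \<le> (\<Sum>l<Suc m. real_of_int (supn d (w l)))"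
        by (intro order_trans[OF sum_abs] sum_mono) auto
      then show ?thesis using c(1) that unfolding rep_def by auto
    qed
    with v show "v \<in> L \<and> (\<forall>k<d. real_of_int \<bar>v k\<bar> \<le> (\<Sum>l<Suc m. real_of_int (supn d (w l))))" by blast
  qed
  then have finE: "finite E" using finite_bounded finite_subset by blast
  define ct where "ct v = (SOME c. rep v c \<and> red c)" for v
  have ct: "rep v (ct v) \<and> red (ct v)" if "v \<in> E" for v
    using that someI_ex[of "\<lambda>c. rep v c \<and> red c"] unfolding E_def ct_def by blast
  have "w m \<in> E"
  proof -
    have "(\<Sum>l<Suc m. (if l = m then 1 else 0) * real_of_int (w l k)) = real_of_int (w m k)" for k
      by (simp add: if_distrib[of "\<lambda>x. x * _"] cong: if_cong)
    then have "rep (w m) (\<lambda>l. if l = m then 1 else 0)" unfolding rep_def by simp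
    then show ?thesis using wL m unfolding E_def red_def by (auto intro!: exI[of _ "\<lambda>l. if l = m then 1 else 0"])
  qed
  then have "Min ((\<lambda>v. ct v m) ` E) \<in> (\<lambda>v. ct v m) ` E" using finE by (intro Min_in) auto
  then obtain y where y: "y \<in> E" and yM: "Min ((\<lambda>v. ct v m) ` E) = ct y m" by blast
  have y_min: "ct y m \<le> ct v m" if "v \<in> E" for v
    unfolding yM[symmetric] using that finE by (intro Min_le) auto
  define \<beta> where "\<beta> = ct y m"
  have yL: "y \<in> L" and yrep: "rep y (ct y)" and \<beta>: "0 < \<beta>" "\<beta> \<le> 1"
    using ct[OF y] y unfolding red_def \<beta>_def E_def by auto
  define z' where "z' = z(m := y)"
  define b' where "b' = b(m := (\<lambda>l. if l \<le> m then ct y l else 0))"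
  have basis: "z' i \<in> L \<and> b' i i > 0 \<and> (\<forall>l>i. b' i l = 0) \<and>
           (\<forall>k<d. real_of_int (z' i k) = (\<Sum>l<r. b' i l * real_of_int (w l k)))" if "i < Suc m" for i
  proof (cases "i = m")
    case True
    have "(\<Sum>l<r. (if l \<le> m then ct y l else 0) * real_of_int (w l k)) = (\<Sum>l<Suc m. ct y l * real_of_int (w l k))" for k
      using m by (intro sum.mono_neutral_cong_right) auto
    then show ?thesis using True yL yrep \<beta> by (auto simp: z'_def b'_def \<beta>_def rep_def)
  next
    case False
    then show ?thesis using zb that by (auto simp: z'_def b'_def)
  qed
  have "\<exists>s::nat \<Rightarrow> int. \<forall>k. v k = (\<Sum>i<Suc m. s i * z' i k)" if vL: "v \<in> L" and vc: "rep v c" for v c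
  proof -
    \<comment> \<open>Division with remainder by \<beta>: the remainder \<open>c1 m\<close> lies in
      [0, \<beta>).\<close>
    define n where "n = \<lfloor>c m / \<beta>\<rfloor>"
    define v1 where "v1 = (\<lambda>k. v k + (- n) * y k)"
    define c1 where "c1 l = c l - n * ct y l" for l
    have v1L: "v1 \<in> L" unfolding v1_def using vL yL by (rule add_mult_mem)
    have r1: "rep v1 c1" unfolding rep_def
    proof (intro allI impI)
      fix k assume "k < d"
      then have "real_of_int (v k) = (\<Sum>l<Suc m. c l * real_of_int (w l k))"
          "real_of_int (y k) = (\<Sum>l<Suc m. ct y l * real_of_int (w l k))"
        using vc yrep unfolding rep_def by blast+
      then show "real_of_int (v1 k) = (\<Sum>l<Suc m. c1 l * real_of_int (w l k))"
        unfolding v1_def c1_def of_int_add of_int_mult of_int_minus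
        by (simp only: left_diff_distrib sum_subtractf sum_distrib_left mult.assoc) (simp add: sum_negf)
    qed
    have c1m: "0 \<le> c1 m" "c1 m < \<beta>"
    proof -
      have "n \<le> c m / \<beta>" "c m / \<beta> < n + 1" unfolding n_def by linarith+
      then show "0 \<le> c1 m" "c1 m < \<beta>" using \<beta> unfolding c1_def \<beta>_def[symmetric] by (auto simp: field_simps)
    qed
    \<comment> \<open>Integer multiples of \<open>w l\<close> with l < m reduce the lower
      coefficients and leave the one at m alone. A nonzero remainder would then put
      \<open>v2\<close> into \<open>E\<close>, against the minimality of \<beta>.\<close>
    define v2 where "v2 = (\<lambda>k. v1 k + (\<Sum>l<m. (- \<lfloor>c1 l\<rfloor>) * w l k))"
    define c2 where "c2 l = (if l < m then c1 l - \<lfloor>c1 l\<rfloor> else c1 l)" for l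
    have v2L: "v2 \<in> L" unfolding v2_def using v1L m wL by (intro add_sum_mem) auto
    have r2: "rep v2 c2" unfolding rep_def
    proof (intro allI impI)
      fix k assume "k < d"
      then have "real_of_int (v1 k) = (\<Sum>l<m. c1 l * real_of_int (w l k)) + c1 m * real_of_int (w m k)"
        using r1 unfolding rep_def by auto
      moreover have "(\<Sum>l<Suc m. c2 l * real_of_int (w l k)) =
          (\<Sum>l<m. (c1 l - \<lfloor>c1 l\<rfloor>) * real_of_int (w l k)) + c1 m * real_of_int (w m k)"
        by (simp add: c2_def)
      ultimately show "real_of_int (v2 k) = (\<Sum>l<Suc m. c2 l * real_of_int (w l k))"
        unfolding v2_def by (simp add: left_diff_distrib sum_subtractf sum_negf)
    qed
    have "c1 m = 0"
    proof (rule ccontr)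
      assume "c1 m \<noteq> 0"
      then have "red c2" using c1m \<beta> unfolding red_def c2_def by (auto; linarith)
      then have "v2 \<in> E" using v2L r2 unfolding E_def by auto
      then have "\<beta> \<le> ct v2 m" unfolding \<beta>_def by (rule y_min)
      also have "ct v2 m = c2 m" using ct[OF \<open>v2 \<in> E\<close>] r2 by (intro rep_unique[of v2]) auto
      finally show False using c1m by (simp add: c2_def)
    qed
    then have "\<forall>k<d. real_of_int (v1 k) = (\<Sum>l<m. c1 l * real_of_int (w l k))"
      using r1 unfolding rep_def by simp
    from gen[rule_format, OF v1L this[rule_format]] obtain s where s: "\<forall>k. v1 k = (\<Sum>i<m. s i * z i k)" by blast
    have "v k = (\<Sum>i<Suc m. (s(m := n)) i * z' i k)" for k
    proof -
      have "(\<Sum>i<m. (s(m := n)) i * z' i k) = (\<Sum>i<m. s i * z i k)"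
        by (intro sum.cong) (auto simp: z'_def)
      then show ?thesis using s[rule_format, of k] by (simp add: z'_def v1_def)
    qed
    then show ?thesis by blast
  qed
  then show ?case using basis unfolding rep_def by (intro exI[of _ z'] exI[of _ b']) blast
qed

text \<open>A basis of the real span of \<open>L\<close> made of lattice vectors; it may generate
  only a subgroup of finite index.\<close>

definition frame :: "nat \<Rightarrow> (nat \<Rightarrow> nat \<Rightarrow> int) \<Rightarrow> bool" where
  "frame r w \<longleftrightarrow> (\<forall>i<r. w i \<in> L) \<and> lin_indep_int d r w \<and>
     (\<forall>v\<in>L. \<exists>c. \<forall>k<d. real_of_int (v k) = (\<Sum>l<r. c l * real_of_int (w l k)))"

text \<open>Steinitz exchange. \<open>expand\<close> turns coefficients for the new family into
  coefficients for the old one; since \<open>b m\<close> is nonzero this substitution is invertible,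
  which yields both independence and spanning.\<close>

lemma frame_exchange:
  assumes w: "frame r w" and y: "y \<in> L" and m: "m < r" and "b m \<noteq> 0"
    and rep: "\<And>k. k < d \<Longrightarrow> real_of_int (y k) = (\<Sum>l<r. b l * real_of_int (w l k))"
  shows "frame r (w(m := y))"
proof -
  have expand: "(\<Sum>l<r. c l * real_of_int ((w(m := y)) l k)) =
      (\<Sum>l<r. (if l = m then c m * b m else c l + c m * b l) * real_of_int (w l k))" if "k < d" for c k
  proof -
    have "(\<Sum>l<r. c l * real_of_int ((w(m := y)) l k)) =
        c m * real_of_int (y k) + (\<Sum>l\<in>{..<r} - {m}. c l * real_of_int (w l k))"
      using m by (subst sum.remove[of _ m]) (auto intro!: sum.cong)
    also have "c m * real_of_int (y k) = c m * b m * real_of_int (w m k) +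
        (\<Sum>l\<in>{..<r} - {m}. c m * b l * real_of_int (w l k))"
      using m by (simp add: rep[OF that] sum.remove[of "{..<r}" m] algebra_simps sum_distrib_left)
    also have "\<dots> + (\<Sum>l\<in>{..<r} - {m}. c l * real_of_int (w l k)) =
        c m * b m * real_of_int (w m k) + (\<Sum>l\<in>{..<r} - {m}. (c l + c m * b l) * real_of_int (w l k))"
      by (simp add: sum.distrib distrib_right)
    also have "\<dots> = (\<Sum>l<r. (if l = m then c m * b m else c l + c m * b l) * real_of_int (w l k))"
      using m by (subst sum.remove[of "{..<r}" m]) (auto intro!: sum.cong)
    finally show ?thesis .
  qed
  have "lin_indep_int d r (w(m := y))"
    unfolding lin_indep_int_def
  proof (intro allI impI)
    fix c i assume c: "\<forall>k<d. (\<Sum>i<r. c i * real_of_int ((w(m := y)) i k)) = 0" and i: "i < r"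
    have 0: "(if l = m then c m * b m else c l + c m * b l) = 0" if "l < r" for l
      by (rule lin_indep_intD[where c = "\<lambda>l. if l = m then c m * b m else c l + c m * b l" and i = l, OF _ _ that])
        (use w c expand in \<open>auto simp: frame_def\<close>)
    have "c m = 0" using 0[OF m] \<open>b m \<noteq> 0\<close> by simp
    then show "c i = 0" using 0[OF i] by (simp split: if_splits)
  qed
  moreover have "\<exists>c. \<forall>k<d. real_of_int (v k) = (\<Sum>l<r. c l * real_of_int ((w(m := y)) l k))" if "v \<in> L" for v
  proof -
    from w that obtain c where c: "\<forall>k<d. real_of_int (v k) = (\<Sum>l<r. c l * real_of_int (w l k))"
      unfolding frame_def by blast
    define c' where "c' l = (if l = m then c m / b m else c l - c m / b m * b l)" for l
    have "(if l = m then c' m * b m else c' l + c' m * b l) = c l" for l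
      using \<open>b m \<noteq> 0\<close> by (simp add: c'_def)
    then have "\<forall>k<d. real_of_int (v k) = (\<Sum>l<r. c' l * real_of_int ((w(m := y)) l k))"
      using c expand[where c = c'] by simp
    then show ?thesis by blast
  qed
  ultimately show ?thesis using w y unfolding frame_def by auto
qed

lemma frame_permute:
  assumes w: "frame r w" and \<sigma>: "bij_betw \<sigma> {..<r} {..<r}"
  shows "frame r (\<lambda>i. w (\<sigma> i))"
proof -
  let ?\<tau> = "the_inv_into {..<r} \<sigma>"
  have \<tau>: "bij_betw ?\<tau> {..<r} {..<r}" using \<sigma> by (rule bij_betw_the_inv_into)
  have \<sigma>\<tau>: "\<sigma> (?\<tau> i) = i" "?\<tau> i < r" if "i < r" for i
    using that \<sigma> bij_betwE[OF \<tau>] by (auto simp: f_the_inv_into_f_bij_betw)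
  have reindex: "(\<Sum>i<r. c i * real_of_int (w (\<sigma> i) k)) = (\<Sum>l<r. c (?\<tau> l) * real_of_int (w l k))" for c k
    by (subst sum.reindex_bij_betw[OF \<tau>, symmetric]) (auto simp: \<sigma>\<tau> intro!: sum.cong)
  have \<sigma>r: "\<sigma> i < r" if "i < r" for i using bij_betwE[OF \<sigma>] that by auto
  have \<tau>\<sigma>: "?\<tau> (\<sigma> i) = i" if "i < r" for i
    using \<sigma> that by (simp add: bij_betw_def the_inv_into_f_f)
  have "lin_indep_int d r (\<lambda>i. w (\<sigma> i))"
    unfolding lin_indep_int_def reindex
  proof (intro allI impI)
    fix c i assume c: "\<forall>k<d. (\<Sum>l<r. c (?\<tau> l) * real_of_int (w l k)) = 0" and i: "i < r"
    have "c (?\<tau> (\<sigma> i)) = 0"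
      by (rule lin_indep_intD[where c = "\<lambda>l. c (?\<tau> l)" and i = "\<sigma> i", OF _ _ \<sigma>r[OF i]])
        (use w c in \<open>auto simp: frame_def\<close>)
    then show "c i = 0" using \<tau>\<sigma>[OF i] by simp
  qed
  moreover have "\<exists>c. \<forall>k<d. real_of_int (v k) = (\<Sum>i<r. c i * real_of_int (w (\<sigma> i) k))" if "v \<in> L" for v
  proof -
    from w that obtain c where c: "\<forall>k<d. real_of_int (v k) = (\<Sum>l<r. c l * real_of_int (w l k))"
      unfolding frame_def by blast
    have "(\<Sum>i<r. c (\<sigma> i) * real_of_int (w (\<sigma> i) k)) = (\<Sum>l<r. c l * real_of_int (w l k))" for k
      using sum.reindex_bij_betw[OF \<sigma>, of "\<lambda>l. c l * real_of_int (w l k)"] .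
    then show ?thesis using c by (intro exI[of _ "\<lambda>i. c (\<sigma> i)"]) simp
  qed
  ultimately show ?thesis using w \<sigma>r unfolding frame_def by auto
qed

text \<open>A frame with least product of norms plays the part of successive minima: a lattice
  vector that involves \<open>w m\<close> and is shorter than it could be exchanged for
  \<open>w m\<close> and would lower the product. Permuting preserves the product, so the frame can
  be sorted as well.\<close>

lemma sorted_minimal_frame:
  assumes "frame r w0"
  obtains w where "frame r w" "\<And>i j. i \<le> j \<Longrightarrow> j < r \<Longrightarrow> supn d (w i) \<le> supn d (w j)"
    "\<And>m y b. m < r \<Longrightarrow> y \<in> L \<Longrightarrow> b m \<noteq> 0 \<Longrightarrow>
       (\<And>k. k < d \<Longrightarrow> real_of_int (y k) = (\<Sum>l<r. b l * real_of_int (w l k))) \<Longrightarrow>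
       supn d (w m) \<le> supn d y"
proof -
  define vol where "vol w = nat (\<Prod>i<r. supn d (w i))" for w :: "nat \<Rightarrow> nat \<Rightarrow> int"
  obtain w1 where w1: "frame r w1" "\<And>w. frame r w \<Longrightarrow> vol w1 \<le> vol w"
    using ex_has_least_nat[of "frame r" w0 vol] assms by blast
  define xs where "xs = sort_key (\<lambda>i. supn d (w1 i)) [0..<r]"
  define \<sigma> where "\<sigma> i = xs ! i" for i
  have xs: "length xs = r" "set xs = {..<r}" "distinct xs" unfolding xs_def by auto
  have \<sigma>: "bij_betw \<sigma> {..<r} {..<r}"
    unfolding \<sigma>_def by (rule bij_betw_nth) (simp_all add: xs)
  define w where "w i = w1 (\<sigma> i)" for i
  have w: "frame r w" unfolding w_def using w1(1) \<sigma> by (rule frame_permute)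
  have "vol w = vol w1" unfolding vol_def w_def
    using prod.reindex_bij_betw[OF \<sigma>, of "\<lambda>i. supn d (w1 i)"] by simp
  then have min: "vol w \<le> vol w'" if "frame r w'" for w' using w1(2)[OF that] by simp
  have "sorted (map (\<lambda>i. supn d (w1 i)) xs)" unfolding xs_def by simp
  then have sorted: "supn d (w i) \<le> supn d (w j)" if "i \<le> j" "j < r" for i j
    using that sorted_nth_mono[of "map (\<lambda>i. supn d (w1 i)) xs" i j] xs by (simp add: w_def \<sigma>_def)
  have "supn d (w m) \<le> supn d y"
    if "m < r" "y \<in> L" "b m \<noteq> 0"
      and rep: "\<And>k. k < d \<Longrightarrow> real_of_int (y k) = (\<Sum>l<r. b l * real_of_int (w l k))" for m y b
  proof -
    have "frame r (w(m := y))" using w that by (intro frame_exchange)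
    then have le: "vol w \<le> vol (w(m := y))" by (rule min)
    have pos: "0 < supn d (w i)" if "i < r" for i
      using w that lin_indep_int_supn_pos unfolding frame_def by blast
    let ?Q = "\<Prod>i\<in>{..<r} - {m}. supn d (w i)"
    have Q: "0 < ?Q" using pos by (intro prod_pos) auto
    have "(\<Prod>i<r. supn d (w i)) = supn d (w m) * ?Q"
      using that(1) by (subst prod.remove[of _ m]) auto
    moreover have "(\<Prod>i<r. supn d ((w(m := y)) i)) = supn d y * ?Q"
      using that(1) by (subst prod.remove[of _ m]) (auto intro!: prod.cong)
    moreover have "0 \<le> supn d y * ?Q" using Q supn_nonneg[of d y] by simp
    ultimately have "supn d (w m) * ?Q \<le> supn d y * ?Q" using le unfolding vol_def by (simp add: nat_le_eq_zle)
    then show ?thesis using Q by simp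
  qed
  then show thesis using that[OF w sorted] by blast
qed

text \<open>
  The following is Henk's argument. With respect to a basis adapted to the flag of \<open>w\<close>, reduce the \<open>i\<close>-th
  coordinate modulo a power of two just above \<open>2R/\<bar>w\<^sub>i\<bar>\<close>. These moduli form a divisibility chain, so a
  collision between two points of norm at most \<open>R\<close> could be divided by the modulus of its top
  coordinate and would give a vector shorter than some \<open>w\<^sub>m\<close> that can replace \<open>w\<^sub>m\<close>.
\<close>

lemma minkowski_second:
  assumes w0: "frame r w0" and \<kappa>: "\<kappa> > 0"
    and count: "\<And>R0. \<exists>R\<ge>R0. \<kappa> * R ^ r \<le> real (card {v \<in> L. \<forall>k<d. real_of_int \<bar>v k\<bar> \<le> R})"
  obtains w where "frame r w" "real_of_int (\<Prod>i<r. supn d (w i)) \<le> 4 ^ r / \<kappa>"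
proof -
  obtain w where w: "frame r w"
    and sorted: "\<And>i j. i \<le> j \<Longrightarrow> j < r \<Longrightarrow> supn d (w i) \<le> supn d (w j)"
    and shortest: "\<And>m y b. m < r \<Longrightarrow> y \<in> L \<Longrightarrow> b m \<noteq> 0 \<Longrightarrow>
       (\<And>k. k < d \<Longrightarrow> real_of_int (y k) = (\<Sum>l<r. b l * real_of_int (w l k))) \<Longrightarrow>
       supn d (w m) \<le> supn d y"
    using sorted_minimal_frame[OF w0] by blast
  have wL: "\<forall>i<r. w i \<in> L" and indep: "lin_indep_int d r w"
    and spans: "\<forall>v\<in>L. \<exists>c. \<forall>k<d. real_of_int (v k) = (\<Sum>l<r. c l * real_of_int (w l k))"
    using w unfolding frame_def by auto
  from adapted_basis[OF wL indep order_refl]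
  obtain z b where zb: "\<forall>i<r. z i \<in> L \<and> b i i > 0 \<and> (\<forall>l>i. b i l = 0) \<and>
           (\<forall>k<d. real_of_int (z i k) = (\<Sum>l<r. b i l * real_of_int (w l k)))"
    and gen: "\<forall>v c. v \<in> L \<longrightarrow> (\<forall>k<d. real_of_int (v k) = (\<Sum>l<r. c l * real_of_int (w l k))) \<longrightarrow>
           (\<exists>s::nat \<Rightarrow> int. \<forall>k. v k = (\<Sum>i<r. s i * z i k))"
    by (elim exE conjE)
  have ex_a: "\<exists>s::nat \<Rightarrow> int. \<forall>k. v k = (\<Sum>i<r. s i * z i k)" if "v \<in> L" for v
    using gen spans that by blast
  define a where "a v = (SOME s::nat \<Rightarrow> int. \<forall>k. v k = (\<Sum>i<r. s i * z i k))" for v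
  have a: "v k = (\<Sum>i<r. a v i * z i k)" if "v \<in> L" for v k
    using someI_ex[OF ex_a[OF that]] unfolding a_def by blast
  define len where "len i = real_of_int (supn d (w i))" for i
  have len_pos: "0 < len i" if "i < r" for i
    using lin_indep_int_supn_pos[OF indep that] by (simp add: len_def)
  \<comment> \<open>R exceeds every norm \<open>len i\<close>, which forces the exponents
    \<open>e i\<close> to be positive; the upper bound \<open>e2\<close> rests on that.\<close>
  obtain R where R: "R \<ge> 1 + (\<Sum>i<r. len i)"
    and card_R: "\<kappa> * R ^ r \<le> real (card {v \<in> L. \<forall>k<d. real_of_int \<bar>v k\<bar> \<le> R})"
    using count by blast
  have R0: "0 < R" using R sum_nonneg[of "{..<r}" len] len_pos by force
  have len_le: "len i \<le> R" if "i < r" for i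
    using R member_le_sum[of i "{..<r}" len] len_pos that by force
  \<comment> \<open>The least power of two above 2R / \<open>len i\<close> is at most twice that
    number. The resulting bound 4R in \<open>e2\<close> is the source of the factor
    \<open>4 ^ r\<close>.\<close>
  define e where "e i = (LEAST e::nat. 2 * R < 2 ^ e * len i)" for i
  have e_ex: "\<exists>e::nat. 2 * R < 2 ^ e * len i" if "i < r" for i
    using real_arch_pow[of 2 "2 * R / len i"] len_pos[OF that] by (auto simp: field_simps)
  have e1: "2 * R < 2 ^ e i * len i" if "i < r" for i
    unfolding e_def by (rule LeastI_ex[OF e_ex[OF that]])
  have e2: "2 ^ e i * len i \<le> 4 * R" if "i < r" for i
  proof -
    have "e i \<noteq> 0"
    proof
      assume "e i = 0"
      then show False using e1[OF that] len_le[OF that] R0 by simp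
    qed
    then obtain f where f: "e i = Suc f" using not0_implies_Suc by blast
    then have "\<not> 2 * R < 2 ^ f * len i" unfolding e_def using not_less_Least lessI by metis
    then show ?thesis using f by (simp add: not_less mult.commute)
  qed
  have e_mono: "e j \<le> e i" if "i \<le> j" "j < r" for i j
  proof -
    have "len i \<le> len j" using sorted[OF that] by (simp add: len_def)
    then have "2 ^ e i * len i \<le> 2 ^ e i * len j" by simp
    then have "2 * R < 2 ^ e i * len j" using e1[of i] that by linarith
    then show ?thesis unfolding e_def[of j] by (rule Least_le)
  qed
  let ?S = "{v \<in> L. \<forall>k<d. real_of_int \<bar>v k\<bar> \<le> R}"
  let ?T = "Pi\<^sub>E {..<r} (\<lambda>i. {0..<2 ^ e i :: int})"
  define \<Phi> where "\<Phi> v = (\<lambda>i\<in>{..<r}. a v i mod 2 ^ e i)" for v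
  have inj: "inj_on \<Phi> ?S"
  proof (rule inj_onI, rule ccontr)
    fix u v assume u: "u \<in> ?S" and v: "v \<in> ?S" and eq: "\<Phi> u = \<Phi> v" and ne: "u \<noteq> v"
    define D where "D i = (a u i - a v i) div 2 ^ e i" for i
    have D: "a u i - a v i = 2 ^ e i * D i" if "i < r" for i
    proof -
      have "a u i mod 2 ^ e i = a v i mod 2 ^ e i" using fun_cong[OF eq, of i] that by (simp add: \<Phi>_def)
      then have "2 ^ e i dvd a u i - a v i" by (simp add: mod_eq_dvd_iff)
      then show ?thesis by (simp add: D_def)
    qed
    have diff: "u k - v k = (\<Sum>i<r. 2 ^ e i * D i * z i k)" for k
    proof -
      have "u k - v k = (\<Sum>i<r. (a u i - a v i) * z i k)"
        using a[of u k] a[of v k] u v by (simp add: left_diff_distrib sum_subtractf)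
      then show ?thesis using D by simp
    qed
    define Z where "Z = {i. i < r \<and> D i \<noteq> 0}"
    have "Z \<noteq> {}"
    proof
      assume "Z = {}"
      then have "u k - v k = 0" for k unfolding diff by (intro sum.neutral) (auto simp: Z_def)
      then show False using ne by auto
    qed
    define m where "m = Max Z"
    have finZ: "finite Z" by (simp add: Z_def)
    have m: "m < r" "D m \<noteq> 0" using Max_in[OF finZ \<open>Z \<noteq> {}\<close>] unfolding m_def Z_def by auto
    have "i \<le> m" if "i \<in> Z" for i unfolding m_def using finZ that by (rule Max_ge)
    then have top: "D i = 0" if "m < i" "i < r" for i
      using that by (force simp: Z_def)
    \<comment> \<open>The difference divided by the modulus of its top index m. The exponents
      decrease as the index grows, so this modulus divides those of all i <= m and y is still a
      lattice vector.\<close>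
    define y where "y = (\<lambda>k. 0 + (\<Sum>i<Suc m. (2 ^ (e i - e m) * D i) * z i k))"
    have yL: "y \<in> L" unfolding y_def using zb m by (intro add_sum_mem zero_mem) auto
    have y_mult: "2 ^ e m * y k = u k - v k" for k
    proof -
      have "2 ^ e m * y k = (\<Sum>i<Suc m. 2 ^ e i * D i * z i k)"
        unfolding y_def add_0_left sum_distrib_left
      proof (rule sum.cong)
        fix i assume "i \<in> {..<Suc m}"
        then have "e m \<le> e i" using m e_mono[of i m] by simp
        then have "2 ^ e m * 2 ^ (e i - e m) = (2 ^ e i :: int)" by (simp flip: power_add)
        then show "2 ^ e m * (2 ^ (e i - e m) * D i * z i k) = 2 ^ e i * D i * z i k"
          by (simp flip: mult.assoc)
      qed simp
      also have "\<dots> = (\<Sum>i<r. 2 ^ e i * D i * z i k)"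
        using m top by (intro sum.mono_neutral_left) auto
      finally show ?thesis using diff by simp
    qed
    define \<beta> where "\<beta> l = (\<Sum>i<Suc m. real_of_int (2 ^ (e i - e m) * D i) * b i l)" for l
    have "real_of_int (y k) = (\<Sum>l<r. \<beta> l * real_of_int (w l k))" if "k < d" for k
    proof -
      have "real_of_int (y k) = (\<Sum>i<Suc m. \<Sum>l<r. real_of_int (2 ^ (e i - e m) * D i) * b i l * real_of_int (w l k))"
        unfolding y_def add_0_left of_int_sum
      proof (rule sum.cong)
        fix i assume "i \<in> {..<Suc m}"
        then have "real_of_int (z i k) = (\<Sum>l<r. b i l * real_of_int (w l k))" using zb m that by auto
        then show "real_of_int (2 ^ (e i - e m) * D i * z i k) =
            (\<Sum>l<r. real_of_int (2 ^ (e i - e m) * D i) * b i l * real_of_int (w l k))"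
          unfolding of_int_mult[of "2 ^ (e i - e m) * D i" "z i k"] by (simp only: sum_distrib_left mult.assoc)
      qed simp
      also have "\<dots> = (\<Sum>l<r. \<beta> l * real_of_int (w l k))"
        unfolding \<beta>_def by (subst sum.swap) (simp only: sum_distrib_right)
      finally show ?thesis .
    qed
    \<comment> \<open>By triangularity of \<open>b\<close> the terms with i < m have no component at
      \<open>w m\<close>, so only \<open>D m * b m m\<close> survives and y may replace
      \<open>w m\<close>.\<close>
    moreover have "\<beta> m \<noteq> 0"
    proof -
      have "\<beta> m = real_of_int (D m) * b m m" unfolding \<beta>_def using zb m by (simp add: sum.lessThan_Suc)
      then show ?thesis using m zb by auto
    qed
    ultimately have "supn d (w m) \<le> supn d y" using shortest[of m y \<beta>] m yL by blast
    then have "2 * R < 2 ^ e m * real_of_int (supn d y)"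
      using e1[OF m(1)] by (smt (verit) len_def of_int_le_iff mult_left_mono zero_le_power)
    moreover have "real_of_int (supn d y) \<le> 2 * R / 2 ^ e m"
    proof -
      have "real_of_int \<bar>y k\<bar> \<le> 2 * R / 2 ^ e m" if "k < d" for k
      proof -
        have "real_of_int \<bar>u k - v k\<bar> \<le> 2 * R" using u v that by fastforce
        then have "real_of_int \<bar>2 ^ e m * y k\<bar> \<le> 2 * R" unfolding y_mult .
        then show ?thesis by (simp add: abs_mult field_simps)
      qed
      then have "\<bar>y k\<bar> \<le> \<lfloor>2 * R / 2 ^ e m\<rfloor>" if "k < d" for k using that by (simp add: le_floor_iff)
      moreover have "0 \<le> 2 * R / 2 ^ e m" using R0 by simp
      ultimately have "supn d y \<le> \<lfloor>2 * R / 2 ^ e m\<rfloor>" unfolding supn_le_iff by simp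
      then show ?thesis by (simp add: le_floor_iff)
    qed
    ultimately show False by (simp add: field_simps)
  qed
  have "\<Phi> ` ?S \<subseteq> ?T" by (auto simp: \<Phi>_def split: if_splits)
  moreover have "finite ?T" by (intro finite_PiE) auto
  ultimately have "card ?S \<le> card ?T" using card_inj_on_le[OF inj] by blast
  also have "card ?T = (\<Prod>i<r. 2 ^ e i)" by (simp add: card_PiE nat_power_eq)
  finally have "real (card ?S) \<le> (\<Prod>i<r. 2 ^ e i)"
    by (metis (mono_tags, lifting) of_nat_le_iff of_nat_prod of_nat_power of_nat_numeral prod.cong)
  then have "\<kappa> * R ^ r \<le> (\<Prod>i<r. 2 ^ e i)" using card_R by linarith
  \<comment> \<open>Multiplication by the norms turns each modulus into a quantity of at most 4R, so
    that \<open>R ^ r\<close> cancels.\<close>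
  then have "\<kappa> * R ^ r * (\<Prod>i<r. len i) \<le> (\<Prod>i<r. 2 ^ e i) * (\<Prod>i<r. len i)"
    using len_pos by (intro mult_right_mono prod_nonneg) (auto intro: less_imp_le)
  also have "\<dots> = (\<Prod>i<r. 2 ^ e i * len i)" by (simp add: prod.distrib)
  also have "\<dots> \<le> (\<Prod>i<r. 4 * R)"
    using e2 len_pos by (intro prod_mono) (auto intro!: mult_nonneg_nonneg less_imp_le)
  also have "\<dots> = 4 ^ r * R ^ r" by (simp add: power_mult_distrib)
  finally have "\<kappa> * (\<Prod>i<r. len i) * R ^ r \<le> 4 ^ r * R ^ r" by (simp add: mult_ac)
  then have "\<kappa> * (\<Prod>i<r. len i) \<le> 4 ^ r" using R0 by simp
  then have "(\<Prod>i<r. len i) \<le> 4 ^ r / \<kappa>" using \<kappa> by (simp add: field_simps)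
  then show thesis using that[OF w] by (simp add: len_def)
qed

end
section \<open>The lattice of the spanned subspace\<close>

text \<open>
  \<open>X h j\<close> is a representative of \<open>\<alpha> j * h\<close> modulo 1 for \<open>j < d\<close>, and coordinate \<open>d\<close> of the point of \<open>h\<close> is
  \<open>h\<close> itself. The chosen coordinates are \<open>f 0 = d, f 1, \<dots>, f (n - 1)\<close>.
\<close>

locale spanned_points =
  fixes d n :: nat and f :: "nat \<Rightarrow> nat" and g :: "nat \<Rightarrow> int" and c :: "nat \<Rightarrow> nat \<Rightarrow> real"
    and P :: "int set" and X :: "int \<Rightarrow> nat \<Rightarrow> real" and \<alpha> :: "nat \<Rightarrow> real" and N :: real
  assumes n_pos: "0 < n" and f_0: "f 0 = d" and f_less: "\<And>i. 0 < i \<Longrightarrow> i < n \<Longrightarrow> f i < d"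
    and f_inj: "inj_on f {..<n}" and g_mem: "\<And>k. k < n \<Longrightarrow> g k \<in> P"
    and rel: "\<And>h j. h \<in> P \<Longrightarrow> j < d \<Longrightarrow> X h j = (\<Sum>i<n. c j i * X h (f i))"
    and c_le: "\<And>j i. j < d \<Longrightarrow> 0 < i \<Longrightarrow> i < n \<Longrightarrow> \<bar>c j i\<bar> \<le> 1"
    and span: "\<And>y. \<exists>s. \<forall>i<n. y i = (\<Sum>k<n. s k * X (g k) (f i))"
    and fin_P: "finite P" and X_d: "\<And>h. X h d = real_of_int h"
    and X_int: "\<And>h j. h \<in> P \<Longrightarrow> j < d \<Longrightarrow> X h j - \<alpha> j * real_of_int h \<in> \<int>"
    and X_le: "\<And>h j. h \<in> P \<Longrightarrow> j < d \<Longrightarrow> \<bar>X h j\<bar> \<le> 1/2"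
    and P_le: "\<And>h. h \<in> P \<Longrightarrow> \<bar>real_of_int h\<bar> \<le> N" and N_ge: "1 \<le> N"
begin

text \<open>
  An integer vector \<open>z\<close> stands for the point with chosen coordinates \<open>xc z i\<close>, so that \<open>Y h\<close> represents
  the point of \<open>h\<close>. The number \<open>\<psi> j z\<close> is coordinate \<open>j\<close> of that point of the span with the shear
  \<open>\<alpha> j * z 0\<close> removed; hence \<open>G\<close> describes the lattice points of the span.
\<close>

definition sh :: "nat \<Rightarrow> real" where "sh i = (if i = 0 then 0 else \<alpha> (f i))"

definition Y :: "int \<Rightarrow> nat \<Rightarrow> int" where
  "Y h i = \<lfloor>X h (f i) - sh i * real_of_int h\<rfloor>"

definition xc :: "(nat \<Rightarrow> int) \<Rightarrow> nat \<Rightarrow> real" where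
  "xc z i = real_of_int (z i) + sh i * real_of_int (z 0)"

definition \<psi> :: "nat \<Rightarrow> (nat \<Rightarrow> int) \<Rightarrow> real" where
  "\<psi> j z = (\<Sum>i<n. c j i * xc z i) - \<alpha> j * real_of_int (z 0)"

definition G :: "(nat \<Rightarrow> int) \<Rightarrow> bool" where "G z \<longleftrightarrow> (\<forall>j<d. \<psi> j z \<in> \<int>)"

section \<open>Points as integer vectors, and the subgroup of lattice points\<close>

lemma Y_0: "Y h 0 = h" by (simp add: Y_def sh_def f_0 X_d)

lemma real_Y: "real_of_int (Y h i) = X h (f i) - sh i * real_of_int h" if "h \<in> P" "i < n"
proof (cases "i = 0")
  case True
  then show ?thesis by (simp add: Y_0 f_0 X_d sh_def)
next
  case False
  then have "X h (f i) - sh i * real_of_int h \<in> \<int>"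
    using X_int[of h "f i"] f_less that by (simp add: sh_def)
  then show ?thesis unfolding Y_def by (metis Ints_cases floor_of_int)
qed

lemma xc_Y: "xc (Y h) i = X h (f i)" if "h \<in> P" "i < n"
  using real_Y[OF that] by (simp add: xc_def Y_0)

lemma xc_add: "xc (\<lambda>i. u i + s * v i) i = xc u i + real_of_int s * xc v i"
  by (simp add: xc_def algebra_simps)

lemma xc_sum: "xc (\<lambda>i. \<Sum>k\<in>A. s k * u k i) i = (\<Sum>k\<in>A. real_of_int (s k) * xc (u k) i)"
  by (simp add: xc_def algebra_simps sum.distrib sum_distrib_left)

lemma \<psi>_add: "\<psi> j (\<lambda>i. u i + s * v i) = \<psi> j u + real_of_int s * \<psi> j v"
  unfolding \<psi>_def xc_add by (simp add: algebra_simps sum.distrib sum_distrib_left)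

lemma \<psi>_sum: "\<psi> j (\<lambda>i. \<Sum>k\<in>A. s k * u k i) = (\<Sum>k\<in>A. real_of_int (s k) * \<psi> j (u k))"
proof -
  have "(\<Sum>i<n. c j i * (\<Sum>k\<in>A. real_of_int (s k) * xc (u k) i)) =
      (\<Sum>k\<in>A. real_of_int (s k) * (\<Sum>i<n. c j i * xc (u k) i))"
    unfolding sum_distrib_left by (subst sum.swap) (simp only: mult.left_commute)
  then show ?thesis unfolding \<psi>_def xc_sum
    by (simp add: right_diff_distrib sum_subtractf sum_distrib_left mult.left_commute)
qed

lemma \<psi>_cong: "(\<And>i. i < n \<Longrightarrow> u i = v i) \<Longrightarrow> \<psi> j u = \<psi> j v"
  using n_pos by (simp add: \<psi>_def xc_def)

lemma G_cong: "(\<And>i. i < n \<Longrightarrow> u i = v i) \<Longrightarrow> G u \<longleftrightarrow> G v"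
  using \<psi>_cong[of u v] by (simp add: G_def)

lemma G_add: "G u \<Longrightarrow> G v \<Longrightarrow> G (\<lambda>i. u i + s * v i)"
  by (simp add: G_def \<psi>_add)

lemma G_diff: "G u \<Longrightarrow> G v \<Longrightarrow> G (\<lambda>i. u i - v i)"
  using G_add[of u v "-1"] by simp

lemma G_sum: "(\<And>k. k \<in> A \<Longrightarrow> G (u k)) \<Longrightarrow> G (\<lambda>i. \<Sum>k\<in>A. s k * u k i)"
  unfolding G_def \<psi>_sum by (auto intro!: Ints_sum)

lemma G_Y: "G (Y h)" if "h \<in> P"
proof -
  have "\<psi> j (Y h) = X h j - \<alpha> j * real_of_int h" if "j < d" for j
    using \<open>h \<in> P\<close> that by (simp add: \<psi>_def xc_Y rel[of h j] Y_0)
  then show ?thesis using X_int[OF that] by (simp add: G_def)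
qed

text \<open>R times the half-open parallelepiped spanned by the points of \<open>g\<close>,
  translated by each point of \<open>P\<close>. At scale R an integer vector stands for a point of
  (1/R)Z^n: R = 1 serves to count cosets, large R to measure volume.\<close>

definition Box :: "nat \<Rightarrow> (nat \<Rightarrow> int) set" where
  "Box R = {z. (\<forall>i\<ge>n. z i = 0) \<and> (\<exists>\<tau>. \<exists>h\<in>P. (\<forall>k<n. 0 \<le> \<tau> k \<and> \<tau> k < 1) \<and>
     (\<forall>i<n. xc z i = real R * (X h (f i) + (\<Sum>k<n. \<tau> k * X (g k) (f i)))))}"

text \<open>Each y in T is moved by R times an element of the subgroup into R times the
  parallelepiped, and then by R times every point of \<open>P\<close>. All these translates are
  distinct and lie in the box.\<close>

lemma packing:
  assumes R: "0 < R" and T: "\<And>y i. y \<in> T \<Longrightarrow> n \<le> i \<Longrightarrow> y i = 0"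
    and incong: "\<And>y y' v. y \<in> T \<Longrightarrow> y' \<in> T \<Longrightarrow> G v \<Longrightarrow> (\<And>i. i < n \<Longrightarrow> y i - y' i = int R * v i) \<Longrightarrow> y = y'"
    and fin: "finite (Box R)"
  shows "finite T \<and> card T * card P \<le> card (Box R)"
proof -
  have "\<exists>s. \<forall>i<n. xc y i / real R = (\<Sum>k<n. s k * X (g k) (f i))" for y
    using span[of "\<lambda>i. xc y i / real R"] .
  then obtain s where s: "\<And>y i. i < n \<Longrightarrow> xc y i / real R = (\<Sum>k<n. s y k * X (g k) (f i))" by metis
  \<comment> \<open>Rounding down the coordinates \<open>s\<close> with respect to the points of
    \<open>g\<close> gives an element of the subgroup; the fractional parts left over become the
    \<tau> of the box.\<close>
  define m where "m y i = (\<Sum>k<n. \<lfloor>s y k\<rfloor> * Y (g k) i)" for y i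
  define F where "F = (\<lambda>(y, h) i. if i < n then y i + int R * (Y h i - m y i) else 0)"
  have Gm: "G (m y)" for y unfolding m_def using g_mem by (intro G_sum G_Y) auto
  have F_mem: "F (y, h) \<in> Box R" if "y \<in> T" "h \<in> P" for y h
  proof -
    have "xc (F (y, h)) i = real R * (X h (f i) + (\<Sum>k<n. (s y k - \<lfloor>s y k\<rfloor>) * X (g k) (f i)))" if i: "i < n" for i
    proof -
      have "xc (F (y, h)) i = xc (\<lambda>i. y i + int R * (Y h i + (-1) * m y i)) i"
        using i n_pos by (simp add: xc_def F_def)
      also have "\<dots> = xc y i + real R * (xc (Y h) i - xc (m y) i)"
        unfolding xc_add by simp
      also have "xc (Y h) i = X h (f i)" using \<open>h \<in> P\<close> i by (rule xc_Y)
      also have "xc (m y) i = (\<Sum>k<n. \<lfloor>s y k\<rfloor> * X (g k) (f i))"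
        unfolding m_def xc_sum using g_mem i by (simp add: xc_Y)
      also have "xc y i = real R * (\<Sum>k<n. s y k * X (g k) (f i))"
        using s[OF i, of y] R by (simp add: field_simps)
      finally show ?thesis by (simp add: algebra_simps sum_subtractf)
    qed
    moreover have "0 \<le> s y k - \<lfloor>s y k\<rfloor> \<and> s y k - \<lfloor>s y k\<rfloor> < 1" for k by linarith
    moreover have "\<forall>i\<ge>n. F (y, h) i = 0" by (simp add: F_def)
    ultimately show ?thesis unfolding Box_def using that(2)
      by (intro CollectI conjI exI[of _ "\<lambda>k. s y k - \<lfloor>s y k\<rfloor>"] bexI[of _ h]) auto
  qed
  have inj: "inj_on F (T \<times> P)"
  proof (rule inj_onI, clarify)
    fix y h y' h'
    assume T': "y \<in> T" "y' \<in> T" and h: "h \<in> P" "h' \<in> P" and eq: "F (y, h) = F (y', h')"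
    have eq': "y i + int R * (Y h i - m y i) = y' i + int R * (Y h' i - m y' i)" if "i < n" for i
      using fun_cong[OF eq, of i] that by (simp add: F_def)
    \<comment> \<open>A collision writes y - y' as R times an element of the subgroup. Once y = y'
      is known, coordinate 0 recovers h, because \<open>Y h 0\<close> is h.\<close>
    have "y = y'"
    proof (rule incong[OF T'])
      show "G (\<lambda>i. (Y h' i - m y' i) - (Y h i - m y i))"
        by (intro G_diff G_Y Gm h)
      show "y i - y' i = int R * ((Y h' i - m y' i) - (Y h i - m y i))" if "i < n" for i
        using eq'[OF that] by (simp add: algebra_simps)
    qed
    moreover from this have "h = h'" using eq'[OF n_pos] R by (simp add: Y_0)
    ultimately show "y = y' \<and> h = h'" by simp
  qed
  have sub: "F ` (T \<times> P) \<subseteq> Box R" using F_mem by auto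
  have "P \<noteq> {}" using g_mem n_pos by auto
  moreover have "finite (T \<times> P)" using inj sub fin by (meson finite_imageD finite_subset)
  ultimately have "finite T" using finite_cartesian_productD1 by blast
  moreover have "card (T \<times> P) \<le> card (Box R)" using inj sub fin by (rule card_inj_on_le)
  ultimately show ?thesis by (simp add: card_cartesian_product)
qed

text \<open>A vector of the box is R times a combination of n + 1 points of \<open>P\<close> with
  weights in [0, 1], so a bound on the points is inherited with the factor R(n + 1).\<close>

lemma Box_functional:
  assumes z: "z \<in> Box R" and l: "\<And>h. h \<in> P \<Longrightarrow> \<bar>\<Sum>i<n. l i * X h (f i)\<bar> \<le> \<epsilon>"
  shows "\<bar>\<Sum>i<n. l i * xc z i\<bar> \<le> real R * (real n + 1) * \<epsilon>"
proof -
  from z obtain \<tau> h where h: "h \<in> P" and \<tau>: "\<And>k. k < n \<Longrightarrow> 0 \<le> \<tau> k \<and> \<tau> k < 1"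
    and xz: "\<And>i. i < n \<Longrightarrow> xc z i = real R * (X h (f i) + (\<Sum>k<n. \<tau> k * X (g k) (f i)))"
    unfolding Box_def by auto
  have "(\<Sum>i<n. l i * xc z i) = real R * ((\<Sum>i<n. l i * X h (f i)) + (\<Sum>i<n. \<Sum>k<n. l i * (\<tau> k * X (g k) (f i))))"
    by (simp add: xz algebra_simps sum.distrib sum_distrib_left)
  also have "(\<Sum>i<n. \<Sum>k<n. l i * (\<tau> k * X (g k) (f i))) = (\<Sum>k<n. \<tau> k * (\<Sum>i<n. l i * X (g k) (f i)))"
    by (subst sum.swap) (simp add: sum_distrib_left mult_ac)
  finally have eq: "(\<Sum>i<n. l i * xc z i) =
    real R * ((\<Sum>i<n. l i * X h (f i)) + (\<Sum>k<n. \<tau> k * (\<Sum>i<n. l i * X (g k) (f i))))" .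
  have \<epsilon>: "0 \<le> \<epsilon>" using l[OF h] by linarith
  have "\<bar>\<Sum>k<n. \<tau> k * (\<Sum>i<n. l i * X (g k) (f i))\<bar> \<le> (\<Sum>k<n. \<epsilon>)"
  proof (intro order_trans[OF sum_abs] sum_mono)
    fix k assume "k \<in> {..<n}"
    then have "\<bar>\<tau> k\<bar> \<le> 1" "\<bar>\<Sum>i<n. l i * X (g k) (f i)\<bar> \<le> \<epsilon>" using \<tau>[of k] l g_mem by auto
    then show "\<bar>\<tau> k * (\<Sum>i<n. l i * X (g k) (f i))\<bar> \<le> \<epsilon>"
      unfolding abs_mult using mult_mono[of "\<bar>\<tau> k\<bar>" 1 _ \<epsilon>] by simp
  qed
  then have "\<bar>(\<Sum>i<n. l i * X h (f i)) + (\<Sum>k<n. \<tau> k * (\<Sum>i<n. l i * X (g k) (f i)))\<bar> \<le> \<epsilon> + real n * \<epsilon>"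
    using l[OF h] by simp
  then have "real R * \<bar>(\<Sum>i<n. l i * X h (f i)) + (\<Sum>k<n. \<tau> k * (\<Sum>i<n. l i * X (g k) (f i)))\<bar> \<le> real R * (\<epsilon> + real n * \<epsilon>)"
    by (intro mult_left_mono) auto
  also have "\<dots> = real R * (real n + 1) * \<epsilon>" by (simp add: algebra_simps)
  finally show ?thesis unfolding eq abs_mult by simp
qed

lemma Box_coord:
  assumes z: "z \<in> Box R" and "i < n" and "\<And>h. h \<in> P \<Longrightarrow> \<bar>X h (f i)\<bar> \<le> \<epsilon>"
  shows "\<bar>xc z i\<bar> \<le> real R * (real n + 1) * \<epsilon>"
proof -
  have "(\<Sum>i'<n. (if i' = i then 1 else 0) * u i') = u i" for u :: "nat \<Rightarrow> real"
    using \<open>i < n\<close> by (simp add: if_distrib[of "\<lambda>x. x * _"] cong: if_cong)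
  then show ?thesis using Box_functional[OF z, of "\<lambda>i'. if i' = i then 1 else 0" \<epsilon>] assms(3) by simp
qed

text \<open>Equal entries at 0 mean equal shears, so the integer difference is a difference of two
  real coordinates, each at most R(n + 1)/2 in absolute value.\<close>

lemma Box_diff:
  assumes "z \<in> Box R" "z' \<in> Box R" "0 < i" "i < n" "z 0 = z' 0"
  shows "real_of_int (z i - z' i) \<le> real R * (real n + 1)"
proof -
  have "\<bar>X h (f i)\<bar> \<le> 1/2" if "h \<in> P" for h using X_le[OF that f_less] assms by auto
  from Box_coord[OF assms(1,4) this] Box_coord[OF assms(2,4) this]
  have "xc z i - xc z' i \<le> real R * (real n + 1) * (1/2) + real R * (real n + 1) * (1/2)" by linarith
  then show ?thesis using assms(5) by (simp add: xc_def)
qed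

lemma Box_diff_0:
  assumes "z \<in> Box R" "z' \<in> Box R"
  shows "real_of_int (z 0 - z' 0) \<le> 2 * real R * (real n + 1) * N"
proof -
  have "\<bar>X h (f 0)\<bar> \<le> N" if "h \<in> P" for h using P_le[OF that] by (simp add: f_0 X_d)
  from Box_coord[OF assms(1) n_pos this] Box_coord[OF assms(2) n_pos this]
  show ?thesis by (simp add: xc_def sh_def abs_le_iff)
qed

lemma Box_eqI: "z = z'" if "z \<in> Box R" "z' \<in> Box R" "\<forall>i<n. z i = z' i"
  using that by (auto simp: Box_def fun_eq_iff) (metis leI)

text \<open>Coordinate 0 is counted first, since the shear cancels in the other coordinates only
  after it has been fixed.\<close>

lemma card_Box:
  "finite (Box R) \<and> real (card (Box R)) \<le>
     (2 * real R * (real n + 1) * N + 1) * (real R * (real n + 1) + 1) ^ (n - 1)"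
proof -
  let ?b = "\<lambda>i. if i = 0 then 2 * real R * (real n + 1) * N else real R * (real n + 1)"
  have "finite (Box R) \<and> real (card (Box R)) \<le> (\<Prod>i<n. ?b i + 1)"
  proof (rule card_le_prod_fibre_widths[where u = "\<lambda>i z. z i"])
    show "0 \<le> ?b i" for i using N_ge by auto
    show "z = z'" if "z \<in> Box R" "z' \<in> Box R" "\<forall>i<n. z i = z' i" for z z'
      using Box_eqI that .
    show "real_of_int (z i - z' i) \<le> ?b i"
      if "i < n" "z \<in> Box R" "z' \<in> Box R" "\<forall>k<i. z k = z' k" for i z z'
      using that Box_diff[of z R z' i] Box_diff_0[of z R z'] by auto
  qed
  moreover obtain r where "n = Suc r" using n_pos by (cases n) auto
  ultimately show ?thesis by (simp add: prod.lessThan_Suc_shift del: prod.lessThan_Suc)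
qed

text \<open>With all other coordinates fixed, the functional l confines coordinate i0 to an interval
  of length 2R(n + 1)\<epsilon> / |l i0|. Counting i0 last therefore replaces one factor of the box
  by the width of the slab.\<close>

lemma card_Box_slab:
  assumes l: "\<And>h. h \<in> P \<Longrightarrow> \<bar>\<Sum>i<n. l i * X h (f i)\<bar> \<le> \<epsilon>" and i0: "0 < i0" "i0 < n" and "l i0 \<noteq> 0"
    and "0 \<le> \<epsilon>"
  shows "real (card (Box R)) \<le> (2 * real R * (real n + 1) * N + 1) *
     (real R * (real n + 1) + 1) ^ (n - 2) * (2 * real R * (real n + 1) * \<epsilon> / \<bar>l i0\<bar> + 1)"
proof -
  let ?b = "\<lambda>i. if i = 0 then 2 * real R * (real n + 1) * N
    else if i = n - 1 then 2 * real R * (real n + 1) * \<epsilon> / \<bar>l i0\<bar> else real R * (real n + 1)"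
  \<comment> \<open>The transposition of i0 and n - 1 puts i0 last; it fixes 0, so coordinate 0
    still comes first.\<close>
  let ?\<sigma> = "\<lambda>i. if i = i0 then n - 1 else if i = n - 1 then i0 else i"
  have \<sigma>\<sigma>: "?\<sigma> (?\<sigma> i) = i" for i by auto
  have \<sigma>_less: "?\<sigma> i < n" if "i < n" for i using that i0 by auto
  have "finite (Box R) \<and> real (card (Box R)) \<le> (\<Prod>i<n. ?b i + 1)"
  proof (rule card_le_prod_fibre_widths[where u = "\<lambda>i z. z (?\<sigma> i)"])
    show "0 \<le> ?b i" for i using N_ge \<open>0 \<le> \<epsilon>\<close> by auto
    show "z = z'" if z: "z \<in> Box R" "z' \<in> Box R" and eq: "\<forall>i<n. z (?\<sigma> i) = z' (?\<sigma> i)" for z z'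
    proof (rule Box_eqI[OF z], intro allI impI)
      fix i assume "i < n"
      then show "z i = z' i" using eq[rule_format, OF \<sigma>_less, of i] unfolding \<sigma>\<sigma> by blast
    qed
    show "real_of_int (z (?\<sigma> i) - z' (?\<sigma> i)) \<le> ?b i"
      if i: "i < n" and z: "z \<in> Box R" "z' \<in> Box R" and eq: "\<forall>k<i. z (?\<sigma> k) = z' (?\<sigma> k)" for i z z'
    proof (cases "i = 0")
      case True
      then show ?thesis using i0 Box_diff_0[OF z] by auto
    next
      case False
      then have z0: "z 0 = z' 0" using eq[rule_format, of 0] i0 by (auto split: if_splits)
      show ?thesis
      proof (cases "i = n - 1")
        case True
        have "z k = z' k" if "k < n" "k \<noteq> i0" for k
        proof -
          have "?\<sigma> k < i" using that True i0 by auto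
          then show ?thesis using eq[rule_format, of "?\<sigma> k"] unfolding \<sigma>\<sigma> by blast
        qed
        then have "xc z k - xc z' k = (if k = i0 then real_of_int (z i0 - z' i0) else 0)" if "k < n" for k
          using that z0 by (auto simp: xc_def)
        then have "(\<Sum>k<n. l k * xc z k) - (\<Sum>k<n. l k * xc z' k) =
            (\<Sum>k<n. l k * (if k = i0 then real_of_int (z i0 - z' i0) else 0))"
          unfolding sum_subtractf[symmetric] right_diff_distrib[symmetric] by (intro sum.cong) auto
        also have "\<dots> = l i0 * real_of_int (z i0 - z' i0)"
          using i0 by (simp add: if_distrib[of "\<lambda>x. _ * x"] cong: if_cong)
        finally have "\<bar>l i0 * real_of_int (z i0 - z' i0)\<bar> \<le> 2 * real R * (real n + 1) * \<epsilon>"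
          using Box_functional[OF z(1) l] Box_functional[OF z(2) l] by (simp add: abs_le_iff)
        then have "\<bar>real_of_int (z i0 - z' i0)\<bar> \<le> 2 * real R * (real n + 1) * \<epsilon> / \<bar>l i0\<bar>"
          using \<open>l i0 \<noteq> 0\<close> unfolding abs_mult by (subst pos_le_divide_eq) (auto simp: mult.commute)
        then have "real_of_int (z i0 - z' i0) \<le> 2 * real R * (real n + 1) * \<epsilon> / \<bar>l i0\<bar>" by linarith
        then show ?thesis using True i0 by (auto split: if_splits)
      next
        case False
        then show ?thesis using \<open>i \<noteq> 0\<close> Box_diff[OF z, of "?\<sigma> i"] z0 i i0 by (auto split: if_splits)
      qed
    qed
  qed
  then have card: "real (card (Box R)) \<le> (\<Prod>i<n. ?b i + 1)" by blast
  define r where "r = n - 2"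
  have r: "n = Suc (Suc r)" using i0 by (simp add: r_def)
  have "(\<Prod>i<r. ?b (Suc i) + 1) = (\<Prod>i<r. real R * (real n + 1) + 1)"
    by (intro prod.cong) (auto simp: r)
  also have "\<dots> = (real R * (real n + 1) + 1) ^ (n - 2)" by (simp add: r_def)
  finally have mid: "(\<Prod>i<r. ?b (Suc i) + 1) = (real R * (real n + 1) + 1) ^ (n - 2)" .
  have "(\<Prod>i<n. ?b i + 1) = (?b 0 + 1) * ((\<Prod>i<r. ?b (Suc i) + 1) * (?b (Suc r) + 1))"
    unfolding r by (simp only: prod.lessThan_Suc_shift[of _ "Suc r"] prod.lessThan_Suc[of _ r])
  also have "\<dots> = (2 * real R * (real n + 1) * N + 1) *
     (real R * (real n + 1) + 1) ^ (n - 2) * (2 * real R * (real n + 1) * \<epsilon> / \<bar>l i0\<bar> + 1)"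
    unfolding mid by (simp add: r)
  finally show ?thesis using card by simp
qed

end

section \<open>The index of the lattice\<close>

lemma card_supported_functions:
  assumes "finite A"
  shows "card {y::'a \<Rightarrow> int. \<forall>i. (i \<in> A \<longrightarrow> y i \<in> S) \<and> (i \<notin> A \<longrightarrow> y i = 0)} = card S ^ card A"
proof -
  let ?B = "{y::'a \<Rightarrow> int. \<forall>i. (i \<in> A \<longrightarrow> y i \<in> S) \<and> (i \<notin> A \<longrightarrow> y i = 0)}"
  have "bij_betw (\<lambda>y. restrict y A) ?B (A \<rightarrow>\<^sub>E S)"
  proof (rule bij_betwI[where g = "\<lambda>y i. if i \<in> A then y i else 0"])
    show "(\<lambda>y. restrict y A) \<in> ?B \<rightarrow> (A \<rightarrow>\<^sub>E S)" by auto
    show "(\<lambda>y i. if i \<in> A then y i else 0) \<in> (A \<rightarrow>\<^sub>E S) \<rightarrow> ?B" by (auto dest: PiE_mem)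
    show "(\<lambda>i. if i \<in> A then restrict y A i else 0) = y" if "y \<in> ?B" for y
      using that by (intro ext) simp
    show "restrict (\<lambda>i. if i \<in> A then y i else 0) A = y" if "y \<in> A \<rightarrow>\<^sub>E S" for y
      using PiE_arb[OF that] by (intro ext) simp
  qed
  then have "card ?B = card (A \<rightarrow>\<^sub>E S)" by (rule bij_betw_same_card)
  then show ?thesis using assms by (simp add: card_PiE)
qed

context spanned_points
begin

section \<open>Cosets of the subgroup and their number\<close>

lemma \<psi>_zero: "\<psi> j (\<lambda>_. 0) = 0"
  by (simp add: \<psi>_def xc_def)

lemma \<psi>_plus: "\<psi> j (\<lambda>i. u i + v i) = \<psi> j u + \<psi> j v"
  using \<psi>_add[of j u 1 v] by simp

lemma \<psi>_minus: "\<psi> j (\<lambda>i. u i - v i) = \<psi> j u - \<psi> j v"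
  using \<psi>_add[of j u "-1" v] by simp

lemma G_zero: "G (\<lambda>_. 0)" by (simp add: G_def \<psi>_zero)

lemma G_minus_commute: "G (\<lambda>i. u i - v i) \<Longrightarrow> G (\<lambda>i. v i - u i)"
  using G_diff[OF G_zero, of "\<lambda>i. u i - v i"] by simp

lemma card_P_pos: "0 < card P"
  using g_mem[OF n_pos] fin_P by (auto simp: card_gt_0_iff)

text \<open>Packing with R = 1 bounds every family of pairwise incongruent vectors, so a largest
  family exists. A vector in no coset of its members could be added, hence it meets every coset and
  its size is the index of the subgroup.\<close>

lemma transversal:
  "\<exists>T. finite T \<and> T \<noteq> {} \<and> (\<forall>y\<in>T. \<forall>y'\<in>T. G (\<lambda>i. y i - y' i) \<longrightarrow> y = y') \<and>
    (\<forall>y. (\<forall>i\<ge>n. y i = 0) \<longrightarrow> (\<exists>t\<in>T. G (\<lambda>i. y i - t i))) \<and>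
    real (card T) * real (card P) \<le> (2 * (real n + 1) * N + 1) * (real n + 2) ^ (n - 1)"
proof -
  define tr where "tr T \<longleftrightarrow> (\<forall>y\<in>T. \<forall>i\<ge>n. y i = 0) \<and> (\<forall>y\<in>T. \<forall>y'\<in>T. G (\<lambda>i. y i - y' i) \<longrightarrow> y = y')" for T
  have pack: "finite T \<and> card T * card P \<le> card (Box 1)" if "tr T" for T
  proof (rule packing)
    show "y i = 0" if "y \<in> T" "n \<le> i" for y i using \<open>tr T\<close> that unfolding tr_def by blast
    show "y = y'" if "y \<in> T" "y' \<in> T" "G v" and *: "\<And>i. i < n \<Longrightarrow> y i - y' i = int 1 * v i" for y y' v
    proof -
      have "G (\<lambda>i. y i - y' i)" using \<open>G v\<close> G_cong[of "\<lambda>i. y i - y' i" v] * by simp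
      then show ?thesis using \<open>tr T\<close> that(1,2) unfolding tr_def by blast
    qed
    show "finite (Box 1)" using card_Box by blast
  qed simp
  have bound: "card T < Suc (card (Box 1))" if "tr T" for T
  proof -
    have "card T \<le> card T * card P" using card_P_pos by simp
    then have "card T \<le> card (Box 1)" using conjunct2[OF pack[OF that]] by (rule order_trans)
    then show ?thesis by (rule le_imp_less_Suc)
  qed
  have "tr {\<lambda>_. 0}" unfolding tr_def by auto
  have "\<exists>T. tr T \<and> (\<forall>T'. tr T' \<longrightarrow> card T' \<le> card T)"
    by (rule ex_has_greatest_nat[of tr "{\<lambda>_. 0}" card "Suc (card (Box 1))", OF \<open>tr {\<lambda>_. 0}\<close>]) (use bound in blast)
  then obtain T where T: "tr T" and T_max: "\<And>T'. tr T' \<Longrightarrow> card T' \<le> card T" by blast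
  have finT: "finite T" using pack[OF T] by blast
  have T_supp: "\<forall>y\<in>T. \<forall>i\<ge>n. y i = 0" and T_inc: "\<forall>y\<in>T. \<forall>y'\<in>T. G (\<lambda>i. y i - y' i) \<longrightarrow> y = y'"
    using T unfolding tr_def by auto
  have "\<forall>y. (\<forall>i\<ge>n. y i = 0) \<longrightarrow> (\<exists>t\<in>T. G (\<lambda>i. y i - t i))"
  proof (intro allI impI, rule ccontr)
    fix y :: "nat \<Rightarrow> int" assume y: "\<forall>i\<ge>n. y i = 0"
    assume no: "\<not> (\<exists>t\<in>T. G (\<lambda>i. y i - t i))"
    have "y \<notin> T"
    proof
      assume "y \<in> T"
      with no have "\<not> G (\<lambda>i. y i - y i)" by blast
      then show False using G_zero by simp
    qed
    have no': "\<not> G (\<lambda>i. t i - y i)" if "t \<in> T" for t using no that G_minus_commute by blast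
    have "tr (insert y T)" unfolding tr_def
    proof (intro conjI ballI impI)
      show "\<forall>i\<ge>n. u i = 0" if "u \<in> insert y T" for u using that y T_supp by auto
      show "u = v" if "u \<in> insert y T" "v \<in> insert y T" and G: "G (\<lambda>i. u i - v i)" for u v
      proof -
        consider "u = v" | "u = y" "v \<in> T" | "v = y" "u \<in> T" | "u \<in> T" "v \<in> T"
          using \<open>u \<in> insert y T\<close> \<open>v \<in> insert y T\<close> by auto
        then show ?thesis
        proof cases
          case 2
          then show ?thesis using G no by auto
        next
          case 3
          then show ?thesis using G no' by auto
        qed (use G T_inc in auto)
      qed
    qed
    then have "card (insert y T) \<le> card T" by (rule T_max)
    then show False using \<open>y \<notin> T\<close> finT by simp
  qed
  moreover have "T \<noteq> {}" using T_max[OF \<open>tr {\<lambda>_. 0}\<close>] by auto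
  moreover have "real (card T) * real (card P) \<le> (2 * (real n + 1) * N + 1) * (real n + 2) ^ (n - 1)"
  proof -
    have "real (card T) * real (card P) \<le> real (card (Box 1))"
      using pack[OF T] by (metis of_nat_mult of_nat_le_iff)
    then show ?thesis using card_Box[of 1] by (simp add: add.commute)
  qed
  ultimately show ?thesis using finT T_inc by (intro exI[of _ T] conjI)
qed

text \<open>Lagrange's theorem: translation by \<open>y\<close> permutes the cosets, so summing over representatives gives the claim.\<close>

lemma card_transversal_\<psi>:
  assumes finT: "finite T"
    and inc: "\<And>y y'. y \<in> T \<Longrightarrow> y' \<in> T \<Longrightarrow> G (\<lambda>i. y i - y' i) \<Longrightarrow> y = y'"
    and reps: "\<And>y. (\<forall>i\<ge>n. y i = 0) \<Longrightarrow> \<exists>t\<in>T. G (\<lambda>i. y i - t i)"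
    and "j < d"
  shows "real (card T) * \<psi> j y \<in> \<int>"
proof -
  have "\<exists>t'\<in>T. G (\<lambda>i. (t i + y i) - t' i)" for t
  proof -
    obtain t' where "t' \<in> T" "G (\<lambda>i. (if i < n then t i + y i else 0) - t' i)"
      using reps[of "\<lambda>i. if i < n then t i + y i else 0"] by auto
    then show ?thesis
      using G_cong[of "\<lambda>i. (if i < n then t i + y i else 0) - t' i" "\<lambda>i. (t i + y i) - t' i"] by auto
  qed
  then obtain \<rho> where \<rho>: "\<And>t. \<rho> t \<in> T" "\<And>t. G (\<lambda>i. (t i + y i) - \<rho> t i)" by metis
  have "inj_on \<rho> T"
  proof (rule inj_onI)
    fix s t assume st: "s \<in> T" "t \<in> T" "\<rho> s = \<rho> t"
    show "s = t" using G_diff[OF \<rho>(2)[of s] \<rho>(2)[of t]] st by (intro inc) auto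
  qed
  then have bij: "bij_betw \<rho> T T"
    using finT \<rho>(1) by (simp add: bij_betw_def endo_inj_surj image_subsetI)
  have "(\<Sum>t\<in>T. \<psi> j (\<lambda>i. (t i + y i) - \<rho> t i)) \<in> \<int>"
    using \<rho>(2) \<open>j < d\<close> by (intro Ints_sum) (auto simp: G_def)
  also have "(\<Sum>t\<in>T. \<psi> j (\<lambda>i. (t i + y i) - \<rho> t i)) =
      (\<Sum>t\<in>T. \<psi> j t) + real (card T) * \<psi> j y - (\<Sum>t\<in>T. \<psi> j (\<rho> t))"
    by (simp add: \<psi>_minus \<psi>_plus sum.distrib sum_subtractf)
  also have "(\<Sum>t\<in>T. \<psi> j (\<rho> t)) = (\<Sum>t\<in>T. \<psi> j t)"
    using bij by (rule sum.reindex_bij_betw)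
  finally show ?thesis by simp
qed

lemma sum_lessThan_n: "(\<Sum>i<n. u i) = u 0 + (\<Sum>i\<in>{1..<n}. u i)" for u :: "nat \<Rightarrow> real"
proof -
  have "{..<n} = insert 0 {1..<n}" using n_pos by auto
  then show ?thesis by simp
qed

lemma \<psi>_0: "\<psi> j y = (\<Sum>i\<in>{1..<n}. c j i * real_of_int (y i))" if "y 0 = 0"
  using that by (simp add: \<psi>_def xc_def sum_lessThan_n)

lemma \<psi>_unit: "\<psi> j (\<lambda>k. if k = i then q else 0) = real_of_int q * c j i" if "0 < i" "i < n"
proof -
  have "\<psi> j (\<lambda>k. if k = i then q else 0) = (\<Sum>k\<in>{1..<n}. c j k * real_of_int (if k = i then q else 0))"
    using that by (intro \<psi>_0) auto
  also have "\<dots> = (\<Sum>k\<in>{1..<n}. if k = i then c j k * real_of_int q else 0)"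
    by (intro sum.cong) auto
  finally show ?thesis using that by simp
qed

lemma \<psi>_unit_0:
  "\<psi> j (\<lambda>k. if k = 0 then 1 else 0) = c j 0 + (\<Sum>i\<in>{1..<n}. c j i * \<alpha> (f i)) - \<alpha> j"
  by (simp add: \<psi>_def xc_def sum_lessThan_n sh_def)

text \<open>The points of \<open>g\<close> span all of R^n in the chosen coordinates, so a linear
  form that vanishes on them is zero. Apply this to the difference between the relation for
  coordinate \<open>f i'\<close> and the trivial relation.\<close>

lemma c_delta:
  assumes "0 < i'" "i' < n" "i < n"
  shows "c (f i') i = (if i = i' then 1 else 0)"
proof -
  let ?k = "\<lambda>i. c (f i') i - (if i = i' then 1 else 0)"
  have 0: "(\<Sum>i<n. ?k i * X h (f i)) = 0" if "h \<in> P" for h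
  proof -
    have "(\<Sum>i<n. (if i = i' then 1 else 0) * X h (f i)) = X h (f i')"
      using assms by (simp add: if_distrib[of "\<lambda>x. x * _"] cong: if_cong)
    then show ?thesis using rel[OF that f_less[OF assms(1,2)]] by (simp add: left_diff_distrib sum_subtractf)
  qed
  obtain s where s: "\<forall>m<n. (if m = i then 1 else 0) = (\<Sum>k<n. s k * X (g k) (f m))"
    using span[of "\<lambda>m. if m = i then 1 else 0"] by blast
  have "?k i = (\<Sum>m<n. ?k m * (if m = i then 1 else 0))"
    using assms(3) by (simp add: if_distrib[of "\<lambda>x. _ * x"] cong: if_cong)
  also have "\<dots> = (\<Sum>m<n. \<Sum>k<n. ?k m * (s k * X (g k) (f m)))"
    using s by (intro sum.cong) (auto simp: sum_distrib_left)
  also have "\<dots> = (\<Sum>k<n. s k * (\<Sum>m<n. ?k m * X (g k) (f m)))"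
    by (subst sum.swap) (simp only: sum_distrib_left mult.left_commute)
  also have "\<dots> = 0" using 0 g_mem by (intro sum.neutral) auto
  finally show ?thesis by simp
qed

text \<open>The integer points of the span with h = 0, with that coordinate dropped; hence index 0
  is absent from the sum.\<close>

definition W :: "(nat \<Rightarrow> int) set" where
  "W = {v. (\<forall>k\<ge>d. v k = 0) \<and>
     (\<forall>j<d. real_of_int (v j) = (\<Sum>i\<in>{1..<n}. c j i * real_of_int (v (f i))))}"

lemma W_lattice: "int_lattice d W"
proof
  show "v k = 0" if "v \<in> W" "d \<le> k" for v k using that by (simp add: W_def)
  show "(\<lambda>_. 0) \<in> W" by (simp add: W_def)
  show "(\<lambda>k. u k + s * v k) \<in> W" if "u \<in> W" "v \<in> W" for u v s
    using that by (simp add: W_def algebra_simps sum.distrib sum_distrib_left)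
qed

text \<open>Recovers a point of \<open>W\<close> from its chosen coordinates. The floor is exact
  when y lies in the subgroup and \<open>y 0 = 0\<close>.\<close>

definition lift :: "(nat \<Rightarrow> int) \<Rightarrow> nat \<Rightarrow> int" where
  "lift y j = (if j < d then \<lfloor>\<Sum>i\<in>{1..<n}. c j i * real_of_int (y i)\<rfloor> else 0)"

lemma lift:
  assumes "y 0 = 0" "G y"
  shows real_lift: "j < d \<Longrightarrow> real_of_int (lift y j) = (\<Sum>i\<in>{1..<n}. c j i * real_of_int (y i))"
    and lift_f: "0 < i \<Longrightarrow> i < n \<Longrightarrow> lift y (f i) = y i"
    and lift_W: "lift y \<in> W"
proof -
  show 1: "real_of_int (lift y j) = (\<Sum>i\<in>{1..<n}. c j i * real_of_int (y i))" if "j < d" for j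
  proof -
    have "(\<Sum>i\<in>{1..<n}. c j i * real_of_int (y i)) \<in> \<int>"
      unfolding \<psi>_0[of y, OF assms(1), symmetric] using assms(2) that unfolding G_def by blast
    then obtain m where m: "(\<Sum>i\<in>{1..<n}. c j i * real_of_int (y i)) = real_of_int m" by (rule Ints_cases)
    show ?thesis using that unfolding lift_def m by simp
  qed
  show 2: "lift y (f i) = y i" if "0 < i" "i < n" for i
  proof -
    have "real_of_int (lift y (f i)) = (\<Sum>i'\<in>{1..<n}. if i' = i then real_of_int (y i') else 0)"
      unfolding 1[OF f_less[OF that]] using that by (intro sum.cong) (auto simp: c_delta)
    also have "\<dots> = real_of_int (y i)" using that by simp
    finally show ?thesis by simp
  qed
  show "lift y \<in> W" unfolding W_def using 1 2 by (auto simp: lift_def intro!: sum.cong)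
qed

text \<open>Distribute a cube of integer vectors over the cosets in T. Differences inside one coset
  lift injectively to \<open>W\<close>, and as the coefficients c are at most 1 the norm grows at
  most by the factor d. This bounds the density of \<open>W\<close> from below by means of the
  index.\<close>

lemma W_count:
  assumes finT: "finite T" and reps: "\<And>y. (\<forall>i\<ge>n. y i = 0) \<Longrightarrow> \<exists>t\<in>T. G (\<lambda>i. y i - t i)"
    and "n \<le> Suc d"
  shows "real \<rho> ^ (n - 1) \<le>
    real (card T) * real (card {v \<in> W. \<forall>k<d. real_of_int \<bar>v k\<bar> \<le> real d * real \<rho>})"
proof -
  let ?S = "{v \<in> W. \<forall>k<d. real_of_int \<bar>v k\<bar> \<le> real d * real \<rho>}"
  define A where "A = {y::nat \<Rightarrow> int. \<forall>i. (i \<in> {1..<n} \<longrightarrow> y i \<in> {0..int \<rho>}) \<and> (i \<notin> {1..<n} \<longrightarrow> y i = 0)}"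
  have A_0: "y i = 0" if "y \<in> A" "i \<notin> {1..<n}" for y i using that unfolding A_def by blast
  have A_b: "0 \<le> y i \<and> y i \<le> int \<rho>" if "y \<in> A" "i \<in> {1..<n}" for y i
    using that unfolding A_def by (metis (mono_tags, lifting) atLeastAtMost_iff mem_Collect_eq)
  have cardA: "card A = (\<rho> + 1) ^ (n - 1)"
    unfolding A_def by (subst card_supported_functions) (auto simp: nat_add_distrib)
  define t where "t y = (SOME s. s \<in> T \<and> G (\<lambda>i. y i - s i))" for y
  have t: "t y \<in> T \<and> G (\<lambda>i. y i - t y i)" if "y \<in> A" for y
  proof -
    have "\<exists>s. s \<in> T \<and> G (\<lambda>i. y i - s i)" using reps[of y] A_0[OF that] by auto
    then show ?thesis unfolding t_def by (rule someI_ex)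
  qed
  have finS: "finite ?S" using int_lattice.finite_bounded[OF W_lattice] .
  have fibre: "card {y \<in> A. t y = s} \<le> card ?S" for s
  proof (cases "{y \<in> A. t y = s} = {}")
    case False
    then obtain y1 where y1: "y1 \<in> A" "t y1 = s" by blast
    \<comment> \<open>All differences are taken from one fixed member \<open>y1\<close> of the
      fibre. They have entry 0 at index 0, and reading the coordinates \<open>f i\<close> of the
      lift recovers y.\<close>
    define F where "F y = lift (\<lambda>i. y i - y1 i)" for y
    have Gd: "G (\<lambda>i. y i - y1 i)" "y 0 - y1 0 = 0" if "y \<in> A" "t y = s" for y
    proof -
      have "G (\<lambda>i. y i - s i)" "G (\<lambda>i. y1 i - s i)" using t[of y] t[of y1] that y1 by auto
      then show "G (\<lambda>i. y i - y1 i)" using G_diff[of "\<lambda>i. y i - s i" "\<lambda>i. y1 i - s i"] by simp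
      show "y 0 - y1 0 = 0" using A_0[of y 0] A_0[of y1 0] that y1 by simp
    qed
    have "inj_on F {y \<in> A. t y = s}"
    proof (rule inj_onI, rule ext)
      fix y z i assume y: "y \<in> {y \<in> A. t y = s}" and z: "z \<in> {y \<in> A. t y = s}" and eq: "F y = F z"
      show "y i = z i"
      proof (cases "i \<in> {1..<n}")
        case True
        then have "F y (f i) = y i - y1 i" "F z (f i) = z i - y1 i"
          unfolding F_def using y z by (auto intro!: lift_f Gd)
        then show ?thesis using fun_cong[OF eq, of "f i"] by simp
      next
        case False
        then show ?thesis using A_0[of y i] A_0[of z i] y z by simp
      qed
    qed
    moreover have "F ` {y \<in> A. t y = s} \<subseteq> ?S"
    proof clarify
      fix y assume y: "y \<in> A" "s = t y"
      note Gy = Gd(2)[OF y(1) y(2)[symmetric]] Gd(1)[OF y(1) y(2)[symmetric]]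
      have "real_of_int \<bar>F y k\<bar> \<le> real d * real \<rho>" if "k < d" for k
      proof -
        have "\<bar>c k i * real_of_int (y i - y1 i)\<bar> \<le> real \<rho>" if "i \<in> {1..<n}" for i
        proof -
          have "\<bar>y i - y1 i\<bar> \<le> int \<rho>" using A_b[OF y(1) that] A_b[OF y1(1) that] by linarith
          then have "\<bar>real_of_int (y i - y1 i)\<bar> \<le> real \<rho>" by linarith
          moreover have "\<bar>c k i\<bar> \<le> 1" using c_le[OF \<open>k < d\<close>, of i] that by auto
          ultimately have "\<bar>c k i\<bar> * \<bar>real_of_int (y i - y1 i)\<bar> \<le> 1 * real \<rho>" by (intro mult_mono) auto
          then show ?thesis by (simp only: abs_mult mult_1)
        qed
        then have "\<bar>\<Sum>i\<in>{1..<n}. c k i * real_of_int (y i - y1 i)\<bar> \<le> (\<Sum>i\<in>{1..<n}. real \<rho>)"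
          by (intro order_trans[OF sum_abs] sum_mono)
        also have "\<dots> \<le> real d * real \<rho>" using \<open>n \<le> Suc d\<close> by (simp add: mult_right_mono)
        finally show ?thesis using real_lift[of "\<lambda>i. y i - y1 i", OF Gy that] by (simp add: F_def)
      qed
      then show "F y \<in> W \<and> (\<forall>k<d. real_of_int \<bar>F y k\<bar> \<le> real d * real \<rho>)"
        using lift_W[of "\<lambda>i. y i - y1 i", OF Gy] by (simp add: F_def)
    qed
    ultimately show ?thesis using finS by (intro card_inj_on_le)
  next
    case True
    then show ?thesis by (simp only: card.empty)
  qed
  have "A = (\<Union>s\<in>T. {y \<in> A. t y = s})" using t by blast
  then have "card A \<le> (\<Sum>s\<in>T. card {y \<in> A. t y = s})" using card_UN_le[OF finT] by metis
  also have "\<dots> \<le> (\<Sum>s\<in>T. card ?S)" by (intro sum_mono fibre)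
  finally have "(\<rho> + 1) ^ (n - 1) \<le> card T * card ?S" unfolding cardA by simp
  then have "real ((\<rho> + 1) ^ (n - 1)) \<le> real (card T) * real (card ?S)"
    unfolding of_nat_mult[symmetric] by (rule of_nat_mono)
  moreover have "real \<rho> ^ (n - 1) \<le> real ((\<rho> + 1) ^ (n - 1))" by (simp add: power_mono)
  ultimately show ?thesis by linarith
qed

text \<open>All translates in the packing lie in a slab whose volume is proportional to \<epsilon> /
  |l i0|; comparing it with the volume that \<open>card P\<close> disjoint translates occupy bounds
  l i0.\<close>

lemma slab:
  assumes l: "\<And>h. h \<in> P \<Longrightarrow> \<bar>\<Sum>i<n. l i * X h (f i)\<bar> \<le> \<epsilon>" and i0: "0 < i0" "i0 < n" and \<epsilon>: "0 < \<epsilon>"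
  shows "\<bar>l i0\<bar> * real (card P) \<le> (2 * (real n + 1) * N + 1) * (real n + 2) ^ (n - 2) * (2 * real n + 3) * \<epsilon>"
proof (cases "l i0 = 0")
  case True
  then show ?thesis using \<epsilon> N_ge by simp
next
  case False
  \<comment> \<open>Refining the lattice by \<open>R\<close> makes the slab many lattice steps wide, so its count is comparable to its volume.\<close>
  define R where "R = nat \<lceil>\<bar>l i0\<bar> / \<epsilon>\<rceil> + 1"
  have R: "0 < R" "\<bar>l i0\<bar> / \<epsilon> \<le> real R" unfolding R_def by (auto, linarith)
  \<comment> \<open>A full set of residues modulo R. They are incongruent already modulo R Z^n, so
    membership in the subgroup need not be examined.\<close>
  define T where "T = {y::nat \<Rightarrow> int. \<forall>i. (i \<in> {..<n} \<longrightarrow> y i \<in> {0..<int R}) \<and> (i \<notin> {..<n} \<longrightarrow> y i = 0)}"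
  have T_0: "y i = 0" if "y \<in> T" "n \<le> i" for y i using that unfolding T_def by auto
  have T_b: "0 \<le> y i \<and> y i < int R" if "y \<in> T" "i < n" for y i
    using that unfolding T_def by (metis (mono_tags, lifting) atLeastLessThan_iff lessThan_iff mem_Collect_eq)
  have cardT: "card T = R ^ n" unfolding T_def by (subst card_supported_functions) auto
  have "finite T \<and> card T * card P \<le> card (Box R)"
  proof (rule packing)
    show "0 < R" by (rule R(1))
    show "y i = 0" if "y \<in> T" "n \<le> i" for y i using T_0 that .
    show "y = y'" if y: "y \<in> T" "y' \<in> T" and v: "\<And>i. i < n \<Longrightarrow> y i - y' i = int R * v i" for y y' v
    proof
      fix i
      show "y i = y' i"
      proof (cases "i < n")
        case True
        have "\<bar>int R * v i\<bar> < int R" using T_b[OF y(1) True] T_b[OF y(2) True] v[OF True] by linarith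
        then have "int R * \<bar>v i\<bar> < int R * 1" by (simp add: abs_mult)
        then have "v i = 0" using R(1) by (simp only: mult_less_cancel_left) auto
        then show ?thesis using v[OF True] by simp
      next
        case False
        then show ?thesis using T_0[OF y(1), of i] T_0[OF y(2), of i] by simp
      qed
    qed
    show "finite (Box R)" using card_Box by blast
  qed
  then have "real (R ^ n) * real (card P) \<le> real (card (Box R))"
    unfolding cardT by (metis of_nat_mult of_nat_le_iff)
  also have "\<dots> \<le> (2 * real R * (real n + 1) * N + 1) *
     (real R * (real n + 1) + 1) ^ (n - 2) * (2 * real R * (real n + 1) * \<epsilon> / \<bar>l i0\<bar> + 1)"
    using card_Box_slab[OF l i0 False less_imp_le[OF \<epsilon>]] .
  \<comment> \<open>Each factor gives up one R: the bound 1 <= R absorbs the summand 1 in the first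
    two kinds, and R >= |l i0| / \<epsilon> absorbs it in the last.\<close>
  also have "\<dots> \<le> (real R * (2 * (real n + 1) * N + 1)) *
     (real R * (real n + 2)) ^ (n - 2) * (real R * ((2 * real n + 3) * \<epsilon> / \<bar>l i0\<bar>))"
  proof (intro mult_mono power_mono)
    have R1: "1 \<le> real R" using R(1) by simp
    show "2 * real R * (real n + 1) * N + 1 \<le> real R * (2 * (real n + 1) * N + 1)"
      using R1 by (simp add: algebra_simps)
    show "real R * (real n + 1) + 1 \<le> real R * (real n + 2)" using R1 by (simp add: algebra_simps)
    have "1 \<le> real R * \<epsilon> / \<bar>l i0\<bar>" using R(2) \<epsilon> False by (simp add: field_simps)
    moreover have "real R * ((2 * real n + 3) * \<epsilon> / \<bar>l i0\<bar>) =
        2 * real R * (real n + 1) * \<epsilon> / \<bar>l i0\<bar> + real R * \<epsilon> / \<bar>l i0\<bar>"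
      using False by (simp add: field_simps)
    ultimately show "2 * real R * (real n + 1) * \<epsilon> / \<bar>l i0\<bar> + 1 \<le> real R * ((2 * real n + 3) * \<epsilon> / \<bar>l i0\<bar>)"
      by linarith
  qed (use N_ge \<epsilon> in auto)
  also have "\<dots> = real (R ^ n) * ((2 * (real n + 1) * N + 1) * (real n + 2) ^ (n - 2) * (2 * real n + 3) * \<epsilon> / \<bar>l i0\<bar>)"
  proof -
    have "n = Suc (Suc (n - 2))" using i0 by simp
    then have "real (R ^ n) = real R * (real R ^ (n - 2) * real R)"
      by (metis of_nat_power power_Suc power_Suc2)
    then show ?thesis by (simp add: power_mult_distrib mult_ac)
  qed
  finally have "real (R ^ n) * real (card P) \<le>
    real (R ^ n) * ((2 * (real n + 1) * N + 1) * (real n + 2) ^ (n - 2) * (2 * real n + 3) * \<epsilon> / \<bar>l i0\<bar>)" .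
  then have "real (card P) \<le> (2 * (real n + 1) * N + 1) * (real n + 2) ^ (n - 2) * (2 * real n + 3) * \<epsilon> / \<bar>l i0\<bar>"
    using R(1) by (subst (asm) mult_le_cancel_left_pos) auto
  then show ?thesis using False by (simp add: pos_le_divide_eq mult.commute)
qed

end

section \<open>Annihilators and tangent vectors\<close>

lemma normRZ_le: "normRZ x \<le> \<bar>x - real_of_int z\<bar>"
proof -
  define m where "m = \<lceil>x - 1/2\<rceil>"
  have m: "real_of_int m - 1 < x - 1/2" "x - 1/2 \<le> real_of_int m"
    unfolding m_def by linarith+
  consider "z = m" | "real_of_int z \<ge> real_of_int m + 1" | "real_of_int z \<le> real_of_int m - 1" by linarith
  then show ?thesis using m unfolding normRZ_def sfrac_def m_def[symmetric] by cases auto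
qed

lemma prod_ge_factor:
  fixes u :: "nat \<Rightarrow> int"
  assumes "\<And>i. i < r \<Longrightarrow> 1 \<le> u i" "i < r"
  shows "u i \<le> (\<Prod>i<r. u i)"
proof -
  have "(\<Prod>i<r. u i) = u i * (\<Prod>i\<in>{..<r} - {i}. u i)" using assms(2) by (subst prod.remove[of _ i]) auto
  moreover have "1 \<le> (\<Prod>i\<in>{..<r} - {i}. u i)" using assms(1) by (intro prod_ge_1) auto
  ultimately show ?thesis using assms by (metis mult_le_cancel_left1 int_one_le_iff_zero_less not_less_iff_gr_or_eq)
qed

context spanned_points
begin

lemma n_le: "n \<le> Suc d"
proof -
  have "f ` {..<n} \<subseteq> {..d}"
  proof clarify
    fix i assume "i < n"
    then show "f i \<le> d" using f_less[of i] f_0 by (cases "i = 0") auto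
  qed
  then have "card (f ` {..<n}) \<le> card {..d}" by (intro card_mono) auto
  then show ?thesis by (simp add: card_image[OF f_inj])
qed

text \<open>The choice of the minor says nothing about \<open>c j 0\<close>. But p integers cannot
  all be small: some h in \<open>P\<close> has |h| >= (p - 1)/2, and the relation at this h, whose
  other terms add up to at most (d + 1)/2, gives the bound.\<close>

lemma c_0_le:
  assumes "j < d" and p: "2 \<le> card P"
  shows "\<bar>c j 0\<bar> \<le> (real d + 1) / (real (card P) - 1)"
proof -
  have "\<exists>h\<in>P. int (card P) - 1 \<le> 2 * \<bar>h\<bar>"
  proof (rule ccontr)
    assume "\<not> ?thesis"
    then have "2 * \<bar>h\<bar> \<le> int (card P) - 2" if "h \<in> P" for h using that by force
    then have "P \<subseteq> {- ((int (card P) - 2) div 2)..(int (card P) - 2) div 2}" by fastforce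
    then have "card P \<le> card {- ((int (card P) - 2) div 2)..(int (card P) - 2) div 2}"
      by (intro card_mono) auto
    then show False using p by simp
  qed
  then obtain h where h: "h \<in> P" "int (card P) - 1 \<le> 2 * \<bar>h\<bar>" by blast
  have "c j 0 * real_of_int h = X h j - (\<Sum>i\<in>{1..<n}. c j i * X h (f i))"
    using rel[OF h(1) \<open>j < d\<close>] by (simp add: sum_lessThan_n f_0 X_d)
  moreover have "\<bar>\<Sum>i\<in>{1..<n}. c j i * X h (f i)\<bar> \<le> (\<Sum>i\<in>{1..<n}. 1/2)"
  proof (intro order_trans[OF sum_abs] sum_mono)
    fix i assume "i \<in> {1..<n}"
    then have "\<bar>c j i\<bar> \<le> 1" "\<bar>X h (f i)\<bar> \<le> 1/2" using c_le \<open>j < d\<close> X_le[OF h(1)] f_less by auto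
    then have "\<bar>c j i\<bar> * \<bar>X h (f i)\<bar> \<le> 1 * (1/2)" by (intro mult_mono) auto
    then show "\<bar>c j i * X h (f i)\<bar> \<le> 1/2" by (simp add: abs_mult)
  qed
  moreover have "(\<Sum>i\<in>{1..<n}. 1/2 :: real) \<le> real d / 2" using n_le by simp
  moreover have "\<bar>X h j\<bar> \<le> 1/2" using X_le[OF h(1) \<open>j < d\<close>] .
  ultimately have "\<bar>c j 0 * real_of_int h\<bar> \<le> (real d + 1) / 2" by (simp add: field_simps)
  moreover have "real_of_int (int (card P) - 1) \<le> real_of_int (2 * \<bar>h\<bar>)"
    using h(2) by (simp only: of_int_le_iff)
  then have "\<bar>c j 0\<bar> * ((real (card P) - 1) / 2) \<le> \<bar>c j 0\<bar> * \<bar>real_of_int h\<bar>"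
    by (intro mult_left_mono) auto
  ultimately have "\<bar>c j 0\<bar> * (real (card P) - 1) \<le> real d + 1" by (simp add: abs_mult field_simps)
  then show ?thesis using p by (subst pos_le_divide_eq) auto
qed

text \<open>Multiplied by q the unit vectors lie in the subgroup, so they lift to \<open>W\<close>.
  By \<open>c_delta\<close> the lifts are diagonal in the chosen coordinates. The shift
  \<open>Suc m\<close> skips index 0, which belongs to h.\<close>

lemma W_frame:
  assumes q: "0 < q" and qc: "\<And>j i. j < d \<Longrightarrow> 0 < i \<Longrightarrow> i < n \<Longrightarrow> real q * c j i \<in> \<int>"
  shows "int_lattice.frame d W (n - 1) (\<lambda>m. lift (\<lambda>k. if k = Suc m then int q else 0))"
proof -
  interpret W: int_lattice d W by (rule W_lattice)
  let ?y = "\<lambda>m k. if k = Suc m then int q else 0"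
  have Gy: "G (?y m)" if "m < n - 1" for m
    using that qc by (auto simp: G_def \<psi>_unit)
  have y0: "?y m 0 = 0" for m by simp
  have lift_eq: "real_of_int (lift (?y m) j) = real q * c j (Suc m)" if "m < n - 1" "j < d" for m j
    using real_lift[OF y0 Gy[OF that(1)] that(2)] \<psi>_unit[of "Suc m" j "int q"] \<psi>_0[of "?y m" j, OF y0] that
    by auto
  have "lin_indep_int d (n - 1) (\<lambda>m. lift (?y m))"
    unfolding lin_indep_int_def
  proof (intro allI impI)
    fix x m assume x: "\<forall>k<d. (\<Sum>i<n - 1. x i * real_of_int (lift (?y i) k)) = 0" and m: "m < n - 1"
    have fm: "f (Suc m) < d" using f_less m by auto
    have "0 = (\<Sum>i<n - 1. x i * real_of_int (lift (?y i) (f (Suc m))))" using x fm by simp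
    also have "\<dots> = (\<Sum>i<n - 1. if i = m then x i * real q else 0)"
      using lift_eq[OF _ fm] m by (intro sum.cong) (auto simp: c_delta)
    finally have "x m * real q = 0" using m by simp
    then show "x m = 0" using q by simp
  qed
  moreover have "\<exists>x. \<forall>k<d. real_of_int (v k) = (\<Sum>l<n - 1. x l * real_of_int (lift (?y l) k))" if v: "v \<in> W" for v
  proof (intro exI allI impI)
    fix k assume k: "k < d"
    have "real_of_int (v k) = (\<Sum>i\<in>{1..<n}. c k i * real_of_int (v (f i)))" using v k by (simp add: W_def)
    also have "\<dots> = (\<Sum>l\<in>{0..<n - 1}. c k (Suc l) * real_of_int (v (f (Suc l))))"
      using sum.shift_bounds_Suc_ivl[of "\<lambda>i. c k i * real_of_int (v (f i))" 0 "n - 1"] n_pos by simp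
    also have "\<dots> = (\<Sum>l<n - 1. real_of_int (v (f (Suc l))) / real q * real_of_int (lift (?y l) k))"
      using q by (intro sum.cong) (auto simp: lift_eq[OF _ k])
    finally show "real_of_int (v k) = (\<Sum>l<n - 1. real_of_int (v (f (Suc l))) / real q * real_of_int (lift (?y l) k))" .
  qed
  ultimately show ?thesis unfolding W.frame_def using lift_W[OF y0 Gy] by blast
qed

text \<open>Minkowski's second theorem for \<open>W\<close>, with the density that
  \<open>W_count\<close> provides along the radii R = d \<rho>.\<close>

lemma short_frame:
  assumes d: "1 \<le> d" and finT: "finite T" "T \<noteq> {}"
    and reps: "\<And>y. (\<forall>i\<ge>n. y i = 0) \<Longrightarrow> \<exists>t\<in>T. G (\<lambda>i. y i - t i)"
    and qc: "\<And>j i. j < d \<Longrightarrow> 0 < i \<Longrightarrow> i < n \<Longrightarrow> real (card T) * c j i \<in> \<int>"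
  obtains w where "\<And>i. i < n - 1 \<Longrightarrow> w i \<in> W" "lin_indep_int d (n - 1) w"
    "real_of_int (\<Prod>i<n - 1. supn d (w i)) \<le> (4 * real d) ^ (n - 1) * real (card T)"
proof -
  interpret W: int_lattice d W by (rule W_lattice)
  have q: "0 < card T" using finT by (simp add: card_gt_0_iff)
  let ?\<kappa> = "1 / (real (card T) * real d ^ (n - 1))"
  obtain w where w: "W.frame (n - 1) w" "real_of_int (\<Prod>i<n - 1. supn d (w i)) \<le> 4 ^ (n - 1) / ?\<kappa>"
  proof (rule W.minkowski_second[OF W_frame[OF q qc]])
    show "0 < ?\<kappa>" using q d by simp
    fix R0 :: real
    define \<rho> where "\<rho> = nat \<lceil>R0\<rceil>"
    have "R0 \<le> real \<rho>" unfolding \<rho>_def by linarith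
    also have "\<dots> \<le> real d * real \<rho>" using d mult_right_mono[of 1 "real d" "real \<rho>"] by simp
    finally have "R0 \<le> real d * real \<rho>" .
    moreover have "?\<kappa> * (real d * real \<rho>) ^ (n - 1) \<le>
        real (card {v \<in> W. \<forall>k<d. real_of_int \<bar>v k\<bar> \<le> real d * real \<rho>})"
      using W_count[OF finT(1) reps n_le, of \<rho>] q d by (simp add: power_mult_distrib field_simps)
    ultimately show "\<exists>R\<ge>R0. ?\<kappa> * R ^ (n - 1) \<le> real (card {v \<in> W. \<forall>k<d. real_of_int \<bar>v k\<bar> \<le> R})"
      by blast
  qed
  then show thesis using that[of w] unfolding W.frame_def by (simp add: power_mult_distrib mult_ac)
qed

text \<open>For every coordinate outside the chosen ones, the relation that expresses it through the
  chosen ones becomes an integer form after multiplication by q. It vanishes on \<open>W\<close>,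
  and its entries are at most q because the c are at most 1.\<close>

lemma annihilators:
  assumes q: "0 < q" and qc: "\<And>j i. j < d \<Longrightarrow> 0 < i \<Longrightarrow> i < n \<Longrightarrow> real q * c j i \<in> \<int>"
    and q0: "\<And>j. j < d \<Longrightarrow> real q * (c j 0 + (\<Sum>i\<in>{1..<n}. c j i * \<alpha> (f i)) - \<alpha> j) \<in> \<int>"
  obtains \<eta> where "lin_indep_int d (d - (n - 1)) \<eta>"
    "\<And>m. m < d - (n - 1) \<Longrightarrow> supn d (\<eta> m) \<le> int q"
    "\<And>m v. m < d - (n - 1) \<Longrightarrow> v \<in> W \<Longrightarrow> dotp d v (\<eta> m) = 0"
    "\<And>m. m < d - (n - 1) \<Longrightarrow> \<exists>j<d. normRZ (\<Sum>k<d. real_of_int (\<eta> m k) * \<alpha> k) \<le> real q * \<bar>c j 0\<bar>"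
proof -
  define J where "J = {..<d} - f ` {1..<n}"
  have sub: "f ` {1..<n} \<subseteq> {..<d}" using f_less by auto
  have "card (f ` {1..<n}) = n - 1" using f_inj by (subst card_image) (auto intro: inj_on_subset)
  then have cardJ: "card J = d - (n - 1)" unfolding J_def using sub by (subst card_Diff_subset) auto
  obtain \<phi> where "bij_betw \<phi> {0..<card J} J" using ex_bij_betw_nat_finite[of J] by (auto simp: J_def)
  then have bij: "bij_betw \<phi> {..<d - (n - 1)} J" by (simp add: cardJ lessThan_atLeast0)
  have \<phi>J: "\<phi> m \<in> J" if "m < d - (n - 1)" for m using bij_betwE[OF bij] that by auto
  have \<phi>d: "\<phi> m < d" and \<phi>f: "\<And>i. i \<in> {1..<n} \<Longrightarrow> \<phi> m \<noteq> f i" if "m < d - (n - 1)" for m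
    using \<phi>J[OF that] by (auto simp: J_def)
  have \<phi>inj: "\<phi> m = \<phi> m' \<longleftrightarrow> m = m'" if "m < d - (n - 1)" "m' < d - (n - 1)" for m m'
    using bij that by (auto simp: bij_betw_def inj_on_def)
  define e where "e m i = \<lfloor>real q * c (\<phi> m) i\<rfloor>" for m i
  have e: "real_of_int (e m i) = real q * c (\<phi> m) i" if "m < d - (n - 1)" "i \<in> {1..<n}" for m i
  proof -
    have "real q * c (\<phi> m) i \<in> \<int>" using qc[OF \<phi>d[OF that(1)], of i] that by auto
    then show ?thesis unfolding e_def by (metis Ints_cases floor_of_int)
  qed
  define \<eta> where "\<eta> m k = (if k = \<phi> m then int q else 0) - (\<Sum>i\<in>{1..<n}. if k = f i then e m i else 0)" for m k
  have dot: "(\<Sum>k<d. real_of_int (\<eta> m k) * v k) = real q * (v (\<phi> m) - (\<Sum>i\<in>{1..<n}. c (\<phi> m) i * v (f i)))"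
    if m: "m < d - (n - 1)" for m v
  proof -
    have "(\<Sum>k<d. real_of_int (\<eta> m k) * v k) =
      (\<Sum>k<d. (if k = \<phi> m then real q * v k else 0) - (\<Sum>i\<in>{1..<n}. if k = f i then real_of_int (e m i) * v k else 0))"
      unfolding \<eta>_def of_int_diff of_int_sum left_diff_distrib sum_distrib_right
      by (intro sum.cong arg_cong2[where f = "(-)"]) auto
    also have "\<dots> = real q * v (\<phi> m) - (\<Sum>i\<in>{1..<n}. \<Sum>k<d. if k = f i then real_of_int (e m i) * v k else 0)"
      unfolding sum_subtractf using \<phi>d[OF m] by (subst (2) sum.swap) simp
    also have "(\<Sum>i\<in>{1..<n}. \<Sum>k<d. if k = f i then real_of_int (e m i) * v k else 0) =
        (\<Sum>i\<in>{1..<n}. real q * (c (\<phi> m) i * v (f i)))"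
      using e[OF m] f_less by (intro sum.cong) auto
    finally show ?thesis by (simp only: right_diff_distrib sum_distrib_left)
  qed
  have \<eta>\<phi>: "\<eta> m (\<phi> m') = (if m' = m then int q else 0)" if "m < d - (n - 1)" "m' < d - (n - 1)" for m m'
  proof -
    have "(\<Sum>i\<in>{1..<n}. if \<phi> m' = f i then e m i else 0) = 0"
      using \<phi>f[OF that(2)] by (intro sum.neutral) auto
    then show ?thesis using \<phi>inj[OF that(2,1)] by (simp add: \<eta>_def)
  qed
  have "lin_indep_int d (d - (n - 1)) \<eta>" unfolding lin_indep_int_def
  proof (intro allI impI)
    fix x m assume x: "\<forall>k<d. (\<Sum>i<d - (n - 1). x i * real_of_int (\<eta> i k)) = 0" and m: "m < d - (n - 1)"
    have "0 = (\<Sum>i<d - (n - 1). x i * real_of_int (\<eta> i (\<phi> m)))" using x \<phi>d[OF m] by simp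
    also have "\<dots> = (\<Sum>i<d - (n - 1). if i = m then x i * real q else 0)"
      using \<eta>\<phi>[OF _ m] by (intro sum.cong) auto
    finally have "x m * real q = 0" using m by simp
    then show "x m = 0" using q by simp
  qed
  moreover have "supn d (\<eta> m) \<le> int q" if m: "m < d - (n - 1)" for m
    unfolding supn_le_iff
  proof (intro conjI allI impI)
    fix k assume "k < d"
    show "\<bar>\<eta> m k\<bar> \<le> int q"
    proof (cases "k \<in> f ` {1..<n}")
      case True
      then obtain i where i: "i \<in> {1..<n}" "k = f i" by blast
      have "(\<Sum>i'\<in>{1..<n}. if k = f i' then e m i' else 0) = (\<Sum>i'\<in>{1..<n}. if i' = i then e m i' else 0)"
        using f_inj i by (intro sum.cong) (auto simp: inj_on_def)
      then have "\<eta> m k = - e m i" using \<phi>f[OF m i(1)] i by (simp add: \<eta>_def)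
      moreover have "\<bar>real_of_int (e m i)\<bar> \<le> real q"
        using e[OF m i(1)] c_le[OF \<phi>d[OF m], of i] i(1) mult_left_mono[of "\<bar>c (\<phi> m) i\<bar>" 1 "real q"]
        by (auto simp: abs_mult)
      ultimately show ?thesis by linarith
    next
      case False
      then have "(\<Sum>i'\<in>{1..<n}. if k = f i' then e m i' else 0) = 0" by (intro sum.neutral) auto
      then show ?thesis by (simp add: \<eta>_def)
    qed
  qed simp
  moreover have "dotp d v (\<eta> m) = 0" if m: "m < d - (n - 1)" and v: "v \<in> W" for m v
  proof -
    have "real_of_int (dotp d v (\<eta> m)) = (\<Sum>k<d. real_of_int (\<eta> m k) * real_of_int (v k))"
      by (simp add: dotp_def mult.commute)
    also have "\<dots> = 0" using dot[OF m, of "\<lambda>k. real_of_int (v k)"] v \<phi>d[OF m] by (simp add: W_def)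
    finally show ?thesis by simp
  qed
  moreover have "\<exists>j<d. normRZ (\<Sum>k<d. real_of_int (\<eta> m k) * \<alpha> k) \<le> real q * \<bar>c j 0\<bar>" if m: "m < d - (n - 1)" for m
  proof -
    \<comment> \<open>By \<open>q0\<close> the value of the form at \<alpha> differs from
      \<open>q * c (\<phi> m) 0\<close> by an integer.\<close>
    obtain z where z: "real q * (c (\<phi> m) 0 + (\<Sum>i\<in>{1..<n}. c (\<phi> m) i * \<alpha> (f i)) - \<alpha> (\<phi> m)) = real_of_int z"
      using q0[OF \<phi>d[OF m]] by (rule Ints_cases)
    have "(\<Sum>k<d. real_of_int (\<eta> m k) * \<alpha> k) - real_of_int (- z) = real q * c (\<phi> m) 0"
      unfolding dot[OF m] of_int_minus z[symmetric] by (simp only: algebra_simps) 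
    then have "normRZ (\<Sum>k<d. real_of_int (\<eta> m k) * \<alpha> k) \<le> \<bar>real q * c (\<phi> m) 0\<bar>"
      using normRZ_le[of _ "- z"] by metis
    then show ?thesis using \<phi>d[OF m] by (auto simp: abs_mult)
  qed
  ultimately show thesis by (rule that)
qed

text \<open>The number Q dominates box volume divided by \<open>card P\<close>, with n replaced by
  its largest value d + 1. It controls the index q as well as the loss in \<open>slab\<close>. The
  dimension r is n - 1.\<close>

lemma small_annihilators_and_tangents:
  assumes d: "1 \<le> d" and \<epsilon>: "0 < \<epsilon>" and a: "\<And>h. h \<in> P \<Longrightarrow> \<bar>\<Sum>k<d. a k * X h k\<bar> \<le> \<epsilon>" and p: "2 \<le> card P"
    and Q: "(2 * (real d + 2) * N + 1) * (real d + 3) ^ d \<le> Q * real (card P)"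
  shows "\<exists>r w \<eta>. r \<le> d \<and> lin_indep_int d r w \<and> real_of_int (\<Prod>i<r. supn d (w i)) \<le> (4 * real d) ^ d * Q \<and>
    lin_indep_int d (d - r) \<eta> \<and> (\<forall>j<d - r. real_of_int (supn d (\<eta> j)) \<le> Q) \<and>
    (\<forall>i<r. \<forall>j<d - r. dotp d (w i) (\<eta> j) = 0) \<and>
    (\<forall>j<d - r. normRZ (\<Sum>k<d. real_of_int (\<eta> j k) * \<alpha> k) \<le> Q * ((real d + 1) / (real (card P) - 1))) \<and>
    (\<forall>i<r. \<bar>\<Sum>k<d. real_of_int (w i k) * a k\<bar> \<le> real d * (Q * (2 * real d + 5) * \<epsilon>) * ((4 * real d) ^ d * Q))"
proof -
  from transversal obtain T where T: "finite T" "T \<noteq> {}"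
    and inc: "\<forall>y\<in>T. \<forall>y'\<in>T. G (\<lambda>i. y i - y' i) \<longrightarrow> y = y'"
    and reps: "\<forall>y. (\<forall>i\<ge>n. y i = 0) \<longrightarrow> (\<exists>t\<in>T. G (\<lambda>i. y i - t i))"
    and cardT: "real (card T) * real (card P) \<le> (2 * (real n + 1) * N + 1) * (real n + 2) ^ (n - 1)"
    by (elim exE conjE)
  note inc = inc[THEN bspec, THEN bspec, THEN mp] and reps = reps[THEN spec, THEN mp]
  define q where "q = card T"
  have q: "0 < q" using T by (simp add: q_def card_gt_0_iff)
  have nd: "real n \<le> real d + 1" using n_le by simp
  have first: "2 * (real n + 1) * N + 1 \<le> 2 * (real d + 2) * N + 1"
    using nd N_ge by (simp add: mult_right_mono)
  have pw: "(real n + 2) ^ m \<le> (real d + 3) ^ d" if "m \<le> d" for m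
  proof -
    have "(real n + 2) ^ m \<le> (real d + 3) ^ m" using nd by (intro power_mono) auto
    also have "\<dots> \<le> (real d + 3) ^ d" using that by (intro power_increasing) auto
    finally show ?thesis .
  qed
  have "real q * real (card P) \<le> (2 * (real d + 2) * N + 1) * (real d + 3) ^ d"
    unfolding q_def using n_le N_ge
    by (intro order_trans[OF cardT] mult_mono first pw) auto
  then have "real q * real (card P) \<le> Q * real (card P)" using Q by linarith
  then have qQ: "real q \<le> Q" using p by simp
  then have Q0: "0 < Q" using q by linarith
  have q\<psi>: "real q * \<psi> j y \<in> \<int>" if "j < d" for j y
    unfolding q_def using T(1) inc reps that by (rule card_transversal_\<psi>)
  have qc: "real q * c j i \<in> \<int>" if "j < d" "0 < i" "i < n" for j i
    using q\<psi>[OF that(1), of "\<lambda>k. if k = i then 1 else 0"] that by (simp add: \<psi>_unit)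
  have q0: "real q * (c j 0 + (\<Sum>i\<in>{1..<n}. c j i * \<alpha> (f i)) - \<alpha> j) \<in> \<int>" if "j < d" for j
    using q\<psi>[OF that] unfolding \<psi>_unit_0[symmetric] .
  obtain \<eta> where \<eta>: "lin_indep_int d (d - (n - 1)) \<eta>"
    and \<eta>1: "\<And>m. m < d - (n - 1) \<Longrightarrow> supn d (\<eta> m) \<le> int q"
    and \<eta>2: "\<And>m v. m < d - (n - 1) \<Longrightarrow> v \<in> W \<Longrightarrow> dotp d v (\<eta> m) = 0"
    and \<eta>3: "\<And>m. m < d - (n - 1) \<Longrightarrow> \<exists>j<d. normRZ (\<Sum>k<d. real_of_int (\<eta> m k) * \<alpha> k) \<le> real q * \<bar>c j 0\<bar>"
    using annihilators[OF q qc q0] by blast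
  obtain w where wW: "\<And>i. i < n - 1 \<Longrightarrow> w i \<in> W" and w: "lin_indep_int d (n - 1) w"
    and w_prod: "real_of_int (\<Prod>i<n - 1. supn d (w i)) \<le> (4 * real d) ^ (n - 1) * real q"
    using short_frame[OF d T reps qc[unfolded q_def]] unfolding q_def by blast
  have "(4 * real d) ^ (n - 1) * real q \<le> (4 * real d) ^ d * Q"
    using d n_le qQ by (intro mult_mono power_increasing) auto
  then have w_prod: "real_of_int (\<Prod>i<n - 1. supn d (w i)) \<le> (4 * real d) ^ d * Q" using w_prod by linarith
  have "real_of_int (supn d (\<eta> j)) \<le> Q" if "j < d - (n - 1)" for j
    using \<eta>1[OF that] qQ by linarith
  moreover have "normRZ (\<Sum>k<d. real_of_int (\<eta> m k) * \<alpha> k) \<le> Q * ((real d + 1) / (real (card P) - 1))"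
    if "m < d - (n - 1)" for m
  proof -
    from \<eta>3[OF that]
    obtain j where j: "j < d" "normRZ (\<Sum>k<d. real_of_int (\<eta> m k) * \<alpha> k) \<le> real q * \<bar>c j 0\<bar>"
      by blast
    have "real q * \<bar>c j 0\<bar> \<le> Q * ((real d + 1) / (real (card P) - 1))"
      using qQ Q0 c_0_le[OF j(1) p] by (intro mult_mono) auto
    then show ?thesis using j(2) by linarith
  qed
  moreover have "\<bar>\<Sum>k<d. real_of_int (w i k) * a k\<bar> \<le> real d * (Q * (2 * real d + 5) * \<epsilon>) * ((4 * real d) ^ d * Q)"
    if i: "i < n - 1" for i
  proof -
    \<comment> \<open>The functional a on the span, in chosen coordinates. Since h = 0 on
      \<open>W\<close>, its value at \<open>w i\<close> involves only \<open>l m\<close> with m >=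
      1, which is what \<open>slab\<close> bounds.\<close>
    define l where "l m = (\<Sum>k<d. a k * c k m)" for m
    have l_le: "\<bar>l m\<bar> \<le> Q * (2 * real d + 5) * \<epsilon>" if m: "m \<in> {1..<n}" for m
    proof -
      have "(\<Sum>i<n. l i * X h (f i)) = (\<Sum>k<d. a k * X h k)" if "h \<in> P" for h
      proof -
        have "(\<Sum>i<n. l i * X h (f i)) = (\<Sum>k<d. \<Sum>i<n. a k * (c k i * X h (f i)))"
          unfolding l_def sum_distrib_right by (subst sum.swap) (simp only: mult.assoc)
        also have "\<dots> = (\<Sum>k<d. a k * X h k)"
          using rel[OF that] by (intro sum.cong) (auto simp: sum_distrib_left)
        finally show ?thesis .
      qed
      then have "\<bar>\<Sum>i<n. l i * X h (f i)\<bar> \<le> \<epsilon>" if "h \<in> P" for h using a that by simp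
      from slab[of l, OF this _ _ \<epsilon>] m
      have "\<bar>l m\<bar> * real (card P) \<le> (2 * (real n + 1) * N + 1) * (real n + 2) ^ (n - 2) * (2 * real n + 3) * \<epsilon>"
        by auto
      also have "\<dots> \<le> (2 * (real d + 2) * N + 1) * (real d + 3) ^ d * (2 * real d + 5) * \<epsilon>"
        using n_le N_ge \<epsilon> nd by (intro mult_mono first pw) auto
      also have "\<dots> \<le> (Q * real (card P)) * (2 * real d + 5) * \<epsilon>"
        using Q \<epsilon> by (intro mult_right_mono) auto
      finally have "\<bar>l m\<bar> * real (card P) \<le> (Q * (2 * real d + 5) * \<epsilon>) * real (card P)" by (simp add: mult_ac)
      then show ?thesis using p by simp
    qed
    \<comment> \<open>All norms are positive integers, so each of them is at most their
      product.\<close>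
    have sw: "real_of_int (supn d (w i)) \<le> (4 * real d) ^ d * Q"
    proof -
      have "1 \<le> supn d (w i)" if "i < n - 1" for i using lin_indep_int_supn_pos[OF w that] by linarith
      then have "supn d (w i) \<le> (\<Prod>i<n - 1. supn d (w i))" using i by (intro prod_ge_factor)
      then show ?thesis using w_prod by linarith
    qed
    have "(\<Sum>k<d. real_of_int (w i k) * a k) = (\<Sum>k<d. \<Sum>m\<in>{1..<n}. a k * c k m * real_of_int (w i (f m)))"
      using wW[OF i] by (intro sum.cong) (auto simp: W_def sum_distrib_left sum_distrib_right mult_ac)
    also have "\<dots> = (\<Sum>m\<in>{1..<n}. l m * real_of_int (w i (f m)))"
      unfolding l_def sum_distrib_right by (rule sum.swap)
    also have "\<bar>\<dots>\<bar> \<le> (\<Sum>m\<in>{1..<n}. (Q * (2 * real d + 5) * \<epsilon>) * ((4 * real d) ^ d * Q))"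
    proof (intro order_trans[OF sum_abs] sum_mono)
      fix m assume m: "m \<in> {1..<n}"
      have "\<bar>w i (f m)\<bar> \<le> supn d (w i)" using f_less m by (intro abs_le_supn) auto
      then have "\<bar>real_of_int (w i (f m))\<bar> \<le> (4 * real d) ^ d * Q" using sw by linarith
      then show "\<bar>l m * real_of_int (w i (f m))\<bar> \<le> (Q * (2 * real d + 5) * \<epsilon>) * ((4 * real d) ^ d * Q)"
        unfolding abs_mult using l_le[OF m] Q0 \<epsilon> by (intro mult_mono) auto
    qed
    also have "\<dots> \<le> real d * ((Q * (2 * real d + 5) * \<epsilon>) * ((4 * real d) ^ d * Q))"
      unfolding sum_constant using n_le Q0 \<epsilon> by (intro mult_right_mono) auto
    finally show ?thesis by (simp only: mult.assoc)
  qed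
  moreover have "n - 1 \<le> d" using n_le by simp
  ultimately show ?thesis using w w_prod \<eta> \<eta>2 wW by (intro exI[of _ "n - 1"] exI[of _ w] exI[of _ \<eta>]) blast
qed

end

section \<open>Reduction to differences\<close>

lemma sfrac_bounds: "-1/2 < sfrac x" "sfrac x \<le> 1/2"
  unfolding sfrac_def by linarith+

lemma sfrac_minus_self: "sfrac x - x \<in> \<int>"
  by (simp add: sfrac_def)

text \<open>Within one class of the pigeonhole the nearest integers agree, so differences of the
  values stay within 2\<kappa>; and the signs agree, so differences of fractional parts stay in
  [-1/2, 1/2] without renewed reduction modulo 1.\<close>

lemma popular_differences:
  fixes d N :: nat and \<kappa> M \<beta> :: real and a \<alpha> :: "nat \<Rightarrow> real"
  defines "H \<equiv> {h \<in> {1..N}. normRZ (\<beta> + (\<Sum>k<d. a k * sfrac (\<alpha> k * real h))) < \<kappa>}"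
  assumes M: "supn d a \<le> M" "0 \<le> M" and "H \<noteq> {}"
  obtains P :: "int set" and X where "finite P"
    "real (card H) \<le> (real d * M + 2) * 2 ^ d * real (card P)"
    "\<And>h. X h d = real_of_int h"
    "\<And>h j. h \<in> P \<Longrightarrow> j < d \<Longrightarrow> X h j - \<alpha> j * real_of_int h \<in> \<int>"
    "\<And>h j. h \<in> P \<Longrightarrow> j < d \<Longrightarrow> \<bar>X h j\<bar> \<le> 1/2"
    "\<And>h. h \<in> P \<Longrightarrow> \<bar>real_of_int h\<bar> \<le> real N"
    "\<And>h. h \<in> P \<Longrightarrow> \<bar>\<Sum>k<d. a k * X h k\<bar> \<le> 2 * \<kappa>"
proof -
  define v where "v h = \<beta> + (\<Sum>k<d. a k * sfrac (\<alpha> k * real h))" for h :: nat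
  define cl where "cl h = (\<lceil>v h - 1/2\<rceil>, {k. k < d \<and> 0 < sfrac (\<alpha> k * real h)})" for h :: nat
  \<comment> \<open>The values \<open>v h\<close> lie in an interval of length dM around \<beta>, so
    their nearest integers lie in [lo, lo + dM + 1], which holds at most dM + 2 integers.\<close>
  define lo where "lo = \<beta> - real d * M / 2 - 1/2"
  define B where "B = {\<lceil>lo\<rceil>..\<lfloor>lo + real d * M + 1\<rfloor>} \<times> Pow {..<d}"
  have finH: "finite H" by (simp add: H_def)
  have finB: "finite B" by (simp add: B_def)
  have dev: "\<bar>v h - \<beta>\<bar> \<le> real d * M / 2" for h
  proof -
    have "\<bar>\<Sum>k<d. a k * sfrac (\<alpha> k * real h)\<bar> \<le> (\<Sum>k<d. M * (1/2))"
    proof (intro order_trans[OF sum_abs] sum_mono)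
      fix k assume "k \<in> {..<d}"
      then have "\<bar>a k\<bar> \<le> M" using abs_le_supn[of k d a] M(1) by simp
      moreover have "\<bar>sfrac (\<alpha> k * real h)\<bar> \<le> 1/2" using sfrac_bounds[of "\<alpha> k * real h"] by linarith
      ultimately show "\<bar>a k * sfrac (\<alpha> k * real h)\<bar> \<le> M * (1/2)"
        unfolding abs_mult using M(2) by (intro mult_mono) auto
    qed
    then show ?thesis by (simp add: v_def)
  qed
  have near: "\<beta> - real d * M / 2 \<le> v h" "v h \<le> \<beta> + real d * M / 2" for h
    using dev[of h] by linarith+
  have "\<lceil>v h - 1/2\<rceil> \<in> {\<lceil>lo\<rceil>..\<lfloor>lo + real d * M + 1\<rfloor>}" for h
  proof -
    have "lo \<le> v h - 1/2" using near[of h] by (simp add: lo_def)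
    moreover have "real_of_int \<lceil>v h - 1/2\<rceil> \<le> lo + real d * M + 1"
      using near[of h] unfolding lo_def by linarith
    ultimately show ?thesis unfolding atLeastAtMost_iff le_floor_iff by (intro conjI ceiling_mono)
  qed
  then have cl: "cl \<in> H \<rightarrow> B" by (auto simp: cl_def B_def)
  then have "B \<noteq> {}" using \<open>H \<noteq> {}\<close> by auto
  from pigeonhole_card[OF cl finH finB this]
  obtain b where b: "card H \<le> card (cl -` {b} \<inter> H) * card B" by blast
  define E where "E = cl -` {b} \<inter> H"
  have "card H > 0" using finH \<open>H \<noteq> {}\<close> by (simp add: card_gt_0_iff)
  then have "E \<noteq> {}" using b unfolding E_def by auto
  then obtain h1 where h1: "h1 \<in> E" by blast
  have finE: "finite E" using finH by (simp add: E_def)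
  have cardB: "real (card B) \<le> (real d * M + 2) * 2 ^ d"
  proof -
    have "real (card {\<lceil>lo\<rceil>..\<lfloor>lo + real d * M + 1\<rfloor>}) \<le> real d * M + 2"
    proof -
      have "real_of_int (\<lfloor>lo + real d * M + 1\<rfloor> + 1 - \<lceil>lo\<rceil>) \<le> real d * M + 2" by linarith
      moreover have "0 \<le> real d * M + 2" using M(2) by simp
      ultimately show ?thesis by simp
    qed
    then have "real (card {\<lceil>lo\<rceil>..\<lfloor>lo + real d * M + 1\<rfloor>}) * 2 ^ d \<le> (real d * M + 2) * 2 ^ d"
      by (intro mult_right_mono) auto
    then show ?thesis by (simp only: B_def card_cartesian_product card_Pow[OF finite_lessThan] card_lessThan of_nat_mult of_nat_power of_nat_numeral)
  qed
  \<comment> \<open>Subtracting one fixed element h1 keeps the number of elements of the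
    class.\<close>
  define P where "P = (\<lambda>h. int h - int h1) ` E"
  define X where "X h k = (if k = d then real_of_int h
    else sfrac (\<alpha> k * (real_of_int h + real h1)) - sfrac (\<alpha> k * real h1))" for h :: int and k
  have "card P = card E" unfolding P_def by (intro card_image inj_onI) simp
  then have "real (card H) \<le> real (card P) * real (card B)"
    using b unfolding E_def[symmetric] of_nat_mult[symmetric] by (simp only: of_nat_le_iff)
  also have "\<dots> \<le> real (card P) * ((real d * M + 2) * 2 ^ d)" using cardB by (intro mult_left_mono) auto
  finally have 1: "real (card H) \<le> (real d * M + 2) * 2 ^ d * real (card P)" by (simp add: mult_ac)
  have P_cases: "\<exists>h'\<in>E. h = int h' - int h1 \<and> real_of_int h + real h1 = real h'" if "h \<in> P" for h
    using that unfolding P_def by auto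
  have same: "cl h' = cl h1" if "h' \<in> E" for h' using that h1 by (auto simp: E_def)
  have 2: "X h j - \<alpha> j * real_of_int h \<in> \<int>" if "h \<in> P" "j < d" for h j
  proof -
    have "X h j - \<alpha> j * real_of_int h = (sfrac (\<alpha> j * (real_of_int h + real h1)) - \<alpha> j * (real_of_int h + real h1)) -
        (sfrac (\<alpha> j * real h1) - \<alpha> j * real h1)" using that by (simp add: X_def algebra_simps)
    then show ?thesis by (simp only: Ints_diff sfrac_minus_self)
  qed
  have 3: "\<bar>X h j\<bar> \<le> 1/2" if h: "h \<in> P" and j: "j < d" for h j
  proof -
    obtain h' where h': "h' \<in> E" "real_of_int h + real h1 = real h'" using P_cases[OF h] by blast
    have "0 < sfrac (\<alpha> j * real h') \<longleftrightarrow> 0 < sfrac (\<alpha> j * real h1)"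
      using same[OF h'(1)] j by (auto simp: cl_def)
    then consider "0 < sfrac (\<alpha> j * real h')" "0 < sfrac (\<alpha> j * real h1)"
      | "sfrac (\<alpha> j * real h') \<le> 0" "sfrac (\<alpha> j * real h1) \<le> 0" by (meson not_less)
    then have "\<bar>sfrac (\<alpha> j * real h') - sfrac (\<alpha> j * real h1)\<bar> \<le> 1/2"
      using sfrac_bounds[of "\<alpha> j * real h'"] sfrac_bounds[of "\<alpha> j * real h1"] by cases linarith+
    then show ?thesis using j by (simp add: X_def h'(2))
  qed
  have 4: "\<bar>real_of_int h\<bar> \<le> real N" if "h \<in> P" for h
  proof -
    from P_cases[OF that] obtain h' where "h' \<in> E" "h = int h' - int h1" by blast
    then show ?thesis using h1 by (auto simp: E_def H_def)
  qed
  have 5: "\<bar>\<Sum>k<d. a k * X h k\<bar> \<le> 2 * \<kappa>" if h: "h \<in> P" for h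
  proof -
    obtain h' where h': "h' \<in> E" "real_of_int h + real h1 = real h'" using P_cases[OF h] by blast
    have "(\<Sum>k<d. a k * X h k) = v h' - v h1"
      by (simp add: v_def X_def h'(2) right_diff_distrib sum_subtractf)
    moreover have "\<lceil>v h' - 1/2\<rceil> = \<lceil>v h1 - 1/2\<rceil>" using same[OF h'(1)] by (simp add: cl_def)
    moreover have "\<bar>v h' - real_of_int \<lceil>v h' - 1/2\<rceil>\<bar> < \<kappa>" "\<bar>v h1 - real_of_int \<lceil>v h1 - 1/2\<rceil>\<bar> < \<kappa>"
      using h'(1) h1 by (auto simp: E_def H_def v_def normRZ_def sfrac_def)
    ultimately show ?thesis by linarith
  qed
  have 0: "finite P" "\<And>h. X h d = real_of_int h" using finE by (simp_all add: P_def X_def)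
  show thesis by (rule that[of P X]; fact 0 1 2 3 4 5)
qed

text \<open>These inequalities allow every factor that depends on d, M or \<delta>, and every
  numerical constant, to be absorbed into powers of the single parameter B.\<close>

lemma size_parameter_bounds:
  fixes \<delta> M :: real and d :: nat
  assumes "1 \<le> d" "0 < \<delta>" "\<delta> < 1/10" "1 \<le> M"
  defines "B \<equiv> real d ^ d * M / \<delta>"
  shows "10 \<le> B" "real d \<le> B" "4 ^ d \<le> B ^ 2" "real d ^ d \<le> B" "M / \<delta> \<le> B"
proof -
  have dd: "1 \<le> real d ^ d" using assms by (intro one_le_power) simp
  have M\<delta>: "10 \<le> M / \<delta>" using assms by (simp add: field_simps)
  have B: "B = real d ^ d * (M / \<delta>)" by (simp add: B_def)
  have "1 * (M / \<delta>) \<le> B" unfolding B using dd M\<delta> by (intro mult_right_mono) auto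
  then show "M / \<delta> \<le> B" by simp
  then show "10 \<le> B" using M\<delta> by simp
  have "real d ^ d * 1 \<le> B" unfolding B using dd M\<delta> by (intro mult_left_mono) auto
  then show ddB: "real d ^ d \<le> B" by simp
  have "real d ^ 1 \<le> real d ^ d" using assms by (intro power_increasing) auto
  then show "real d \<le> B" unfolding power_one_right using ddB by linarith
  \<comment> \<open>For d >= 2 compare \<open>2 ^ d\<close> with \<open>d ^ d\<close>; at d = 1 that
    comparison fails and B >= 10 takes its place.\<close>
  show "4 ^ d \<le> B ^ 2"
  proof (cases "d = 1")
    case True
    have "10 ^ 2 \<le> B ^ 2" using \<open>10 \<le> B\<close> by (intro power_mono) auto
    then show ?thesis using True by simp
  next
    case False
    then have "2 ^ d \<le> real d ^ d" using assms(1) by (intro power_mono) auto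
    then have "(2 ^ d) ^ 2 \<le> B ^ 2" using ddB by (intro power_mono) auto
    moreover have "(4::real) ^ d = (2 ^ d) ^ 2" by (simp add: power_mult[symmetric] mult.commute[of d] power_mult)
    ultimately show ?thesis by simp
  qed
qed

section \<open>Assembly and bookkeeping of exponents\<close>

lemma ex_spanned_points:
  assumes h0: "h0 \<in> P" "X h0 d \<noteq> 0" and P: "finite P" "\<And>h. X h d = real_of_int h"
    "\<And>h j. h \<in> P \<Longrightarrow> j < d \<Longrightarrow> X h j - \<alpha> j * real_of_int h \<in> \<int>"
    "\<And>h j. h \<in> P \<Longrightarrow> j < d \<Longrightarrow> \<bar>X h j\<bar> \<le> 1/2"
    "\<And>h. h \<in> P \<Longrightarrow> \<bar>real_of_int h\<bar> \<le> N" "1 \<le> N"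
  shows "\<exists>n f g c. spanned_points d n f g c P X \<alpha> N"
proof (rule spanning_minor[of h0 P X d, OF h0])
  fix n :: nat and f :: "nat \<Rightarrow> nat" and g c
  assume "0 < n" "f 0 = d" "\<And>i. 0 < i \<Longrightarrow> i < n \<Longrightarrow> f i < d" "inj_on f {..<n}"
    "\<And>k. k < n \<Longrightarrow> g k \<in> P"
    "\<And>h j. h \<in> P \<Longrightarrow> j < d \<Longrightarrow> X h j = (\<Sum>i<n. c j i * X h (f i))"
    "\<And>j i. j < d \<Longrightarrow> 0 < i \<Longrightarrow> i < n \<Longrightarrow> \<bar>c j i\<bar> \<le> 1"
    "\<And>y. \<exists>s. \<forall>i<n. y i = (\<Sum>k<n. s k * X (g k) (f i))"
  then have "spanned_points d n f g c P X \<alpha> N" using P by (rule spanned_points.intro)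
  then show ?thesis by blast
qed

lemma bracket_structure:
  fixes d N :: nat and \<delta> K M \<beta> :: real and \<alpha> a :: "nat \<Rightarrow> real"
  assumes d: "1 \<le> d" and \<delta>: "0 < \<delta>" "\<delta> < 1/10" and K: "2 \<le> K" and M: "1 \<le> M" "supn d a \<le> M"
    and many: "\<delta> * real N \<le>
      real (card {h \<in> {1..N}. normRZ (\<beta> + (\<Sum>k<d. a k * sfrac (\<alpha> k * real h))) < K / real N})"
  defines "B \<equiv> real d ^ d * M / \<delta>"
  assumes N: "2 * B ^ 4 \<le> real N"
  shows "\<exists>r w \<eta>. r \<le> d \<and> lin_indep_int d r w \<and> real_of_int (\<Prod>i<r. supn d (w i)) \<le> B ^ 12 \<and>
    lin_indep_int d (d - r) \<eta> \<and> (\<forall>j<d - r. real_of_int (supn d (\<eta> j)) \<le> B ^ 9) \<and>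
    (\<forall>i<r. \<forall>j<d - r. dotp d (w i) (\<eta> j) = 0) \<and>
    (\<forall>j<d - r. normRZ (\<Sum>k<d. real_of_int (\<eta> j k) * \<alpha> k) \<le> B ^ 15 * (K / real N)) \<and>
    (\<forall>i<r. \<bar>\<Sum>k<d. real_of_int (w i k) * a k\<bar> \<le> B ^ 25 * (K / real N))"
proof -
  note B = size_parameter_bounds[OF d \<delta> M(1), folded B_def]
  have B0: "0 < B" "1 \<le> B" "7 \<le> B" "4 \<le> B" "3 \<le> B" using B(1) by linarith+
  have d1: "1 \<le> real d" using d by simp
  have "0 < B ^ 4" using B0 by simp
  then have N0: "0 < real N" using N by linarith
  let ?H = "{h \<in> {1..N}. normRZ (\<beta> + (\<Sum>k<d. a k * sfrac (\<alpha> k * real h))) < K / real N}"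
  have "0 < \<delta> * real N" using \<delta> N0 by simp
  then have pos: "0 < real (card ?H)" using many by linarith
  have "?H \<noteq> {}"
  proof
    assume "?H = {}"
    then have "real (card ?H) = 0" by (simp only: card.empty of_nat_0)
    then show False using pos by linarith
  qed
  obtain P X where P: "finite P" and cardH: "real (card ?H) \<le> (real d * M + 2) * 2 ^ d * real (card P)"
    and X_d: "\<And>h. X h d = real_of_int h"
    and X_int: "\<And>h j. h \<in> P \<Longrightarrow> j < d \<Longrightarrow> X h j - \<alpha> j * real_of_int h \<in> \<int>"
    and X_le: "\<And>h j. h \<in> P \<Longrightarrow> j < d \<Longrightarrow> \<bar>X h j\<bar> \<le> 1/2"
    and P_le: "\<And>h. h \<in> P \<Longrightarrow> \<bar>real_of_int h\<bar> \<le> real N"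
    and aX: "\<And>h. h \<in> P \<Longrightarrow> \<bar>\<Sum>k<d. a k * X h k\<bar> \<le> 2 * (K / real N)"
    using popular_differences[OF M(2) _ \<open>?H \<noteq> {}\<close>] M(1) by auto
  let ?p = "real (card P)"
  \<comment> \<open>The pigeonhole loss: \<open>4 ^ d\<close> costs B^2, and 3 and M / \<delta> cost
    one B each. The factor \<delta> is kept apart to cancel against the density.\<close>
  have "(real d * M + 2) * 2 ^ d \<le> \<delta> * B ^ 4"
  proof -
    have "(real d * M + 2) * 2 ^ d \<le> (3 * (2 ^ d * M)) * 2 ^ d"
    proof (intro mult_right_mono)
      have "real d \<le> 2 ^ d" by (metis less_exp less_imp_le of_nat_le_iff of_nat_numeral of_nat_power)
      then have "real d * M \<le> 2 ^ d * M" using M(1) by (intro mult_right_mono) auto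
      moreover have "1 * 1 \<le> 2 ^ d * M" using M(1) by (intro mult_mono) auto
      ultimately show "real d * M + 2 \<le> 3 * (2 ^ d * M)" by linarith
    qed simp
    also have "\<dots> = 3 * M * 4 ^ d" by (simp add: power_mult_distrib[symmetric] mult_ac)
    also have "\<dots> \<le> 3 * M * B ^ 2" using B(3) M(1) by (intro mult_left_mono) auto
    also have "\<dots> = \<delta> * (3 * (M / \<delta>) * B ^ 2)" using \<delta> by simp
    also have "\<dots> \<le> \<delta> * (B * B * B ^ 2)"
      using \<delta> M(1) B B0 by (intro mult_left_mono mult_mono) auto
    also have "\<dots> = \<delta> * B ^ 4" by (simp add: power2_eq_square power4_eq_xxxx)
    finally show ?thesis .
  qed
  then have "(real d * M + 2) * 2 ^ d * ?p \<le> \<delta> * B ^ 4 * ?p" by (intro mult_right_mono) auto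
  then have "\<delta> * real N \<le> \<delta> * (B ^ 4 * ?p)" using many cardH by (simp add: mult.assoc)
  then have Np: "real N \<le> B ^ 4 * ?p" using \<delta> by simp
  then have "2 * B ^ 4 \<le> B ^ 4 * ?p" using N by linarith
  then have p2: "2 \<le> card P" using B0 by simp
  \<comment> \<open>A nonzero h0 supplies the 1 x 1 minor in coordinate d from which
    \<open>spanning_minor\<close> starts.\<close>
  have "\<exists>h0\<in>P. h0 \<noteq> 0"
  proof (rule ccontr)
    assume "\<not> ?thesis"
    then have "card P \<le> card {0::int}" by (intro card_mono) auto
    then show False using p2 by simp
  qed
  then obtain h0 where h0: "h0 \<in> P" "X h0 d \<noteq> 0" using X_d by auto
  obtain n f g c where "spanned_points d n f g c P X \<alpha> (real N)"
    using ex_spanned_points[of h0 P X d \<alpha> "real N", OF h0 P X_d X_int X_le P_le] N0 by auto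
  then interpret spanned_points d n f g c P X \<alpha> "real N" .
  \<comment> \<open>The exponent 9: two from 7d, four from N <= B^4 p, two from
    \<open>4 ^ d\<close>, one from \<open>d ^ d\<close>.\<close>
  have "(2 * (real d + 2) * real N + 1) * (real d + 3) ^ d \<le> B ^ 9 * ?p"
  proof -
    have "2 * (real d + 2) * real N + 1 \<le> 7 * real d * real N"
    proof -
      have "1 \<le> real N" "real N \<le> real d * real N" using N0 d1 by auto
      then have "2 * (real d * real N) + 4 * real N + 1 \<le> 7 * (real d * real N)" by linarith
      then show ?thesis by (simp add: algebra_simps)
    qed
    moreover have "(real d + 3) ^ d \<le> (4 * real d) ^ d" using d1 by (intro power_mono) auto
    ultimately have "(2 * (real d + 2) * real N + 1) * (real d + 3) ^ d \<le> (7 * real d * real N) * (4 ^ d * real d ^ d)"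
      using N0 d1 unfolding power_mult_distrib[symmetric] by (intro mult_mono) auto
    also have "\<dots> \<le> (B * B * (B ^ 4 * ?p)) * (B ^ 2 * B)"
      using B B0 Np d1 N0 by (intro mult_mono) auto
    also have "\<dots> = B ^ 9 * ?p" by (simp add: algebra_simps power_numeral_reduce)
    finally show ?thesis .
  qed
  from small_annihilators_and_tangents[of "2 * (K / real N)" a "B ^ 9", OF d _ aX p2 this]
  obtain r w \<eta> where "r \<le> d" "lin_indep_int d r w" "lin_indep_int d (d - r) \<eta>"
    and w: "real_of_int (\<Prod>i<r. supn d (w i)) \<le> (4 * real d) ^ d * B ^ 9"
    and \<eta>: "\<forall>j<d - r. real_of_int (supn d (\<eta> j)) \<le> B ^ 9"
    and orth: "\<forall>i<r. \<forall>j<d - r. dotp d (w i) (\<eta> j) = 0"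
    and \<eta>\<alpha>: "\<forall>j<d - r. normRZ (\<Sum>k<d. real_of_int (\<eta> j k) * \<alpha> k) \<le> B ^ 9 * ((real d + 1) / (?p - 1))"
    and wa: "\<forall>i<r. \<bar>\<Sum>k<d. real_of_int (w i k) * a k\<bar> \<le>
      real d * (B ^ 9 * (2 * real d + 5) * (2 * (K / real N))) * ((4 * real d) ^ d * B ^ 9)"
    using K N0 by auto
  have KN: "0 < K / real N" using K N0 by simp
  have w_le: "(4 * real d) ^ d * B ^ 9 \<le> B ^ 12"
  proof -
    have "(4 * real d) ^ d * B ^ 9 \<le> (B ^ 2 * B) * B ^ 9"
      unfolding power_mult_distrib using B B0 by (intro mult_mono) auto
    also have "\<dots> = B ^ 12" by (simp add: power_numeral_reduce)
    finally show ?thesis .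
  qed
  \<comment> \<open>Since p >= 2, p - 1 is at least p/2. Six powers join the nine: four from N <=
    B^4 p, one from d, one from the constant 4.\<close>
  have "B ^ 9 * ((real d + 1) / (?p - 1)) \<le> B ^ 15 * (K / real N)"
  proof -
    have "real N \<le> B ^ 4 * (2 * (?p - 1))"
      using Np p2 B0 by (intro order_trans[OF Np] mult_left_mono) auto
    then have "1 / (?p - 1) \<le> 2 * B ^ 4 / real N" using p2 N0 by (simp add: field_simps)
    then have "(real d + 1) * (1 / (?p - 1)) \<le> (2 * B) * (2 * B ^ 4 / real N)"
      using B B0 d1 p2 by (intro mult_mono) auto
    also have "\<dots> = 4 * B ^ 5 / real N" by (simp add: power_numeral_reduce)
    also have "\<dots> \<le> B * B ^ 5 * K / real N"
    proof -
      have "4 * B ^ 5 * 1 \<le> B * B ^ 5 * K" using B0 K by (intro mult_mono) auto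
      then show ?thesis using N0 by (intro divide_right_mono) auto
    qed
    finally have "B ^ 9 * ((real d + 1) / (?p - 1)) \<le> B ^ 9 * (B * B ^ 5 * K / real N)"
      using B0 by (intro mult_left_mono) auto
    also have "\<dots> = B ^ 15 * (K / real N)" by (simp add: power_numeral_reduce)
    finally show ?thesis .
  qed
  then have \<eta>\<alpha>: "\<forall>j<d - r. normRZ (\<Sum>k<d. real_of_int (\<eta> j k) * \<alpha> k) \<le> B ^ 15 * (K / real N)"
    using \<eta>\<alpha> by (meson order_trans)
  \<comment> \<open>The exponent 25 is 1 for d, 9 for the index, 2 for 2d + 5, 1 for the factor 2
    and 12 for the norm of w.\<close>
  have "real d * (B ^ 9 * (2 * real d + 5) * (2 * (K / real N))) * ((4 * real d) ^ d * B ^ 9) \<le> B ^ 25 * (K / real N)"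
  proof -
    have "2 * real d + 5 \<le> B * B"
    proof -
      have "2 * real d + 5 \<le> 7 * real d" using d1 by simp
      also have "\<dots> \<le> B * B" using B B0 by (intro mult_mono) auto
      finally show ?thesis .
    qed
    then have "real d * (B ^ 9 * (2 * real d + 5) * (2 * \<kappa>)) * ((4 * real d) ^ d * B ^ 9) \<le>
        B * (B ^ 9 * (B * B) * (B * \<kappa>)) * B ^ 12" if "0 < \<kappa>" for \<kappa>
      using B B0 w_le d1 that by (intro mult_mono) auto
    from this[OF KN]
    have "real d * (B ^ 9 * (2 * real d + 5) * (2 * (K / real N))) * ((4 * real d) ^ d * B ^ 9) \<le>
        B * (B ^ 9 * (B * B) * (B * (K / real N))) * B ^ 12" .
    also have "\<dots> = B ^ 25 * (K / real N)" by (simp add: power_numeral_reduce)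
    finally show ?thesis .
  qed
  then have "\<forall>i<r. \<bar>\<Sum>k<d. real_of_int (w i k) * a k\<bar> \<le> B ^ 25 * (K / real N)"
    using wa by (meson order_trans)
  moreover have "real_of_int (\<Prod>i<r. supn d (w i)) \<le> B ^ 12" using w w_le by linarith
  ultimately show ?thesis
    using \<open>r \<le> d\<close> \<open>lin_indep_int d r w\<close> \<open>lin_indep_int d (d - r) \<eta>\<close> \<eta> orth \<eta>\<alpha> by blast
qed

theorem lemmal:
  shows "\<exists>C::real. C > 0 \<and>
    (\<forall>(d::nat) (\<delta>::real) (K::real) (M::real) (N::nat) (\<alpha>::nat \<Rightarrow> real) (a::nat \<Rightarrow> real) (\<beta>::real).
      d \<ge> 1 \<longrightarrow> 0 < \<delta> \<longrightarrow> \<delta> < 1/10 \<longrightarrow> K \<ge> 2 \<longrightarrow> M \<ge> 1 \<longrightarrow> N \<ge> 2 \<longrightarrow>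
      supn d a \<le> M \<longrightarrow>
      real (card {h \<in> {1..N}. normRZ (\<beta> + (\<Sum>k<d. a k * sfrac (\<alpha> k * real h))) < K / real N})
         \<ge> \<delta> * real N \<longrightarrow>
      (let X = \<delta> / (real d ^ d * M) in
        (real N \<le> C * X powr (-C) \<or> K / real N > 1/100) \<or>
        (\<exists>(r::nat) (w::nat \<Rightarrow> nat \<Rightarrow> int) (\<eta>::nat \<Rightarrow> nat \<Rightarrow> int).
           r \<le> d \<and>
           lin_indep_int d r w \<and>
           real_of_int (\<Prod>i<r. supn d (w i)) \<le> X powr (-C) \<and>
           lin_indep_int d (d - r) \<eta> \<and>
           (\<forall>j<d - r. real_of_int (supn d (\<eta> j)) \<le> X powr (-C)) \<and>
           (\<forall>i<r. \<forall>j<d - r. dotp d (w i) (\<eta> j) = 0) \<and>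
           (\<forall>j<d - r. normRZ (\<Sum>k<d. real_of_int (\<eta> j k) * \<alpha> k)
               \<le> (\<delta> / M) powr (-C) * real d powr (C * real d) * K / real N) \<and>
           (\<forall>i<r. \<bar>\<Sum>k<d. real_of_int (w i k) * a k\<bar>
               \<le> (\<delta> / M) powr (-C) * real d powr (C * real d) * K / real N))))"
proof (intro exI[of _ 40] conjI allI impI)
  show "(0::real) < 40" by simp
  fix d N :: nat and \<delta> K M \<beta> :: real and \<alpha> a :: "nat \<Rightarrow> real"
  assume d: "1 \<le> d" and \<delta>: "0 < \<delta>" "\<delta> < 1/10" and K: "2 \<le> K" and M: "1 \<le> M" and "2 \<le> N"
    and a: "supn d a \<le> M"
    and many: "\<delta> * real N \<le>
      real (card {h \<in> {1..N}. normRZ (\<beta> + (\<Sum>k<d. a k * sfrac (\<alpha> k * real h))) < K / real N})"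
  define B where "B = real d ^ d * M / \<delta>"
  have B1: "1 \<le> B" using size_parameter_bounds(1)[OF d \<delta> M] by (simp add: B_def)
  have dd: "0 < real d ^ d" using d by simp
  have X_powr: "(\<delta> / (real d ^ d * M)) powr (-40) = B ^ 40"
    using \<delta> M dd by (simp add: powr_minus B_def power_divide)
  have \<delta>M_powr: "(\<delta> / M) powr (-40) * real d powr (40 * real d) = B ^ 40"
  proof -
    have "real d powr (40 * real d) = real d powr real (d * 40)" by (simp add: mult.commute)
    also have "\<dots> = (real d ^ d) ^ 40" using d by (simp only: powr_realpow power_mult)
    finally show ?thesis using \<delta> M by (simp add: powr_minus B_def power_divide power_mult_distrib)
  qed
  \<comment> \<open>The constant 40 dominates the exponents 9, 12, 15 and 25. If N exceeds 40 B^40,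
    then also N >= 2 B^4, which is the size that \<open>bracket_structure\<close> asks for.\<close>
  have mono: "B ^ m \<le> B ^ 40" if "m \<le> 40" for m using that B1 by (intro power_increasing)
  have KN: "0 \<le> K / real N" using K by simp
  show "let X = \<delta> / (real d ^ d * M) in
        (real N \<le> 40 * X powr (-40) \<or> K / real N > 1/100) \<or>
        (\<exists>(r::nat) (w::nat \<Rightarrow> nat \<Rightarrow> int) (\<eta>::nat \<Rightarrow> nat \<Rightarrow> int).
           r \<le> d \<and>
           lin_indep_int d r w \<and>
           real_of_int (\<Prod>i<r. supn d (w i)) \<le> X powr (-40) \<and>
           lin_indep_int d (d - r) \<eta> \<and>
           (\<forall>j<d - r. real_of_int (supn d (\<eta> j)) \<le> X powr (-40)) \<and>
           (\<forall>i<r. \<forall>j<d - r. dotp d (w i) (\<eta> j) = 0) \<and>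
           (\<forall>j<d - r. normRZ (\<Sum>k<d. real_of_int (\<eta> j k) * \<alpha> k)
               \<le> (\<delta> / M) powr (-40) * real d powr (40 * real d) * K / real N) \<and>
           (\<forall>i<r. \<bar>\<Sum>k<d. real_of_int (w i k) * a k\<bar>
               \<le> (\<delta> / M) powr (-40) * real d powr (40 * real d) * K / real N))"
    unfolding Let_def X_powr \<delta>M_powr
  proof (cases "real N \<le> 40 * B ^ 40")
    case False
    have "2 * B ^ 4 \<le> 40 * B ^ 40" using mono[of 4] B1 by (intro mult_mono) auto
    then have "2 * B ^ 4 \<le> real N" using False by linarith
    from bracket_structure[OF d \<delta> K M a many this[unfolded B_def]]
    obtain r w \<eta> where r: "r \<le> d" "lin_indep_int d r w" "lin_indep_int d (d - r) \<eta>"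
      and w: "real_of_int (\<Prod>i<r. supn d (w i)) \<le> B ^ 12"
      and \<eta>: "\<forall>j<d - r. real_of_int (supn d (\<eta> j)) \<le> B ^ 9"
      and orth: "\<forall>i<r. \<forall>j<d - r. dotp d (w i) (\<eta> j) = 0"
      and \<eta>\<alpha>: "\<forall>j<d - r. normRZ (\<Sum>k<d. real_of_int (\<eta> j k) * \<alpha> k) \<le> B ^ 15 * (K / real N)"
      and wa: "\<forall>i<r. \<bar>\<Sum>k<d. real_of_int (w i k) * a k\<bar> \<le> B ^ 25 * (K / real N)"
      unfolding B_def[symmetric] by (elim exE conjE)
    have le: "B ^ m * (K / real N) \<le> B ^ 40 * K / real N" if "m \<le> 40" for m
      using mult_right_mono[OF mono[OF that] KN] by simp
    have "real_of_int (\<Prod>i<r. supn d (w i)) \<le> B ^ 40" using w mono[of 12] by linarith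
    moreover have "\<forall>j<d - r. real_of_int (supn d (\<eta> j)) \<le> B ^ 40" using \<eta> mono[of 9] by force
    moreover have "\<forall>j<d - r. normRZ (\<Sum>k<d. real_of_int (\<eta> j k) * \<alpha> k) \<le> B ^ 40 * K / real N"
      using \<eta>\<alpha> le[of 15] by force
    moreover have "\<forall>i<r. \<bar>\<Sum>k<d. real_of_int (w i k) * a k\<bar> \<le> B ^ 40 * K / real N"
      using wa le[of 25] by force
    ultimately show "(real N \<le> 40 * B ^ 40 \<or> K / real N > 1/100) \<or>
        (\<exists>(r::nat) (w::nat \<Rightarrow> nat \<Rightarrow> int) (\<eta>::nat \<Rightarrow> nat \<Rightarrow> int).
           r \<le> d \<and>
           lin_indep_int d r w \<and>
           real_of_int (\<Prod>i<r. supn d (w i)) \<le> B ^ 40 \<and>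
           lin_indep_int d (d - r) \<eta> \<and>
           (\<forall>j<d - r. real_of_int (supn d (\<eta> j)) \<le> B ^ 40) \<and>
           (\<forall>i<r. \<forall>j<d - r. dotp d (w i) (\<eta> j) = 0) \<and>
           (\<forall>j<d - r. normRZ (\<Sum>k<d. real_of_int (\<eta> j k) * \<alpha> k) \<le> B ^ 40 * K / real N) \<and>
           (\<forall>i<r. \<bar>\<Sum>k<d. real_of_int (w i k) * a k\<bar> \<le> B ^ 40 * K / real N))"
      using r orth by blast
  qed blast
qed

end
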